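(* Let $T_1,\ldots ,T_n$ be commuting contractions on a complex Hilbert space $\mathcal{H}$ such that their product $T=\prod_{i=1}^nT_i$ is a $C_{\cdot 0}$ contraction. If there are projections $P_1,\ldots ,P_n$ and commuting unitaries $U_1,\ldots ,U_n$ in $\mathcal{B}(\mathcal{D}_{T^*})$ satisfying the following for all $i,j\in\{1,\dots,n\}$: (1) $D_{T^*}T_i^*=P_i^{\perp}U_i^*D_{T^*}+P_iU_i^*D_{T^*}T^*$, (2) $P_i^{\perp}U_i^*P_j^{\perp}U_j^*=P_j^{\perp}U_j^*P_i^{\perp}U_i^*$, (3) $U_iP_iU_jP_j=U_jP_jU_iP_i$, then $(T_1, \dots , T_n)$ is unitarily equivalent to $(\widetilde{T}_1, \dots , \widetilde{T}_n)$ acting on the space $\mathbb H_T=H^2(\mathcal D_{T^*})\ominus M_{\Theta_T}(H^2(\mathcal D_T))$, where $\widetilde{T}_i=P_{\mathbb H_T}(M_{U_iP_i^{\perp}+zU_iP_i})|_{\mathbb H_T}$ for $1\leq i \leq n$.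
   Context: All operators are bounded operators on complex Hilbert spaces. A contraction is an operator of norm at most $1$. A contraction $T$ is a $C_{\cdot 0}$ contraction if ${T^*}^k\to 0$ strongly as $k\to\infty$. For a contraction $T$ on $\mathcal H$, $D_T=(I-T^*T)^{1/2}$, $D_{T^*}=(I-TT^* )^{1/2}$, $\mathcal D_T=\overline{\mathrm{Ran}}\,D_T$, $\mathcal D_{T^*}=\overline{\mathrm{Ran}}\,D_{T^*}$. Projections are orthogonal; for a projection $P$, $P^\perp=I-P$. For a Hilbert space $E$, $H^2(E)$ is the Hardy space of analytic functions $f(z)=\sum_{k\ge 0}a_kz^k$ from the unit disk $\mathbb D$ to $E$ with $\sum\|a_k\|^2<\infty$; for a bounded analytic operator-valued function $\phi$, $M_\phi$ is the multiplication operator $(M_\phi f)(z)=\phi(z)f(z)$. The characteristic function of $T$ is $\Theta_T(z)=[-T+zD_{T^*}(I-zT^* )^{-1}D_T]|_{\mathcal D_T}$, with values in $\mathcal B(\mathcal D_T,\mathcal D_{T^*})$, and $M_{\Theta_T}:H^2(\mathcal D_T)\to H^2(\mathcal D_{T^*})$ is the corresponding multiplication operator. $P_{\mathbb H_T}$ is the orthogonal projection of $H^2(\mathcal D_{T^*})$ onto $\mathbb H_T$. Unitary equivalence of tuples means that a single unitary intertwines the tuples entrywise. *)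

theory Defs
  imports "HOL-Analysis.Analysis"
begin

section \<open>Complex Hilbert spaces\<close>

text \<open>
  The complex inner product is linear in its first argument.  Its real part is the inner product
  of \<^class>\<open>real_inner\<close>, so that norm, topology and completeness are those of the library.
\<close>

class complex_inner = real_inner +
  fixes scaleC :: "complex \<Rightarrow> 'a \<Rightarrow> 'a" (infixr "*\<^sub>C" 75)
    and cinner :: "'a \<Rightarrow> 'a \<Rightarrow> complex"
  assumes scaleC_add_right: "c *\<^sub>C (x + y) = c *\<^sub>C x + c *\<^sub>C y"
    and scaleC_add_left: "(c + d) *\<^sub>C x = c *\<^sub>C x + d *\<^sub>C x"
    and scaleC_scaleC: "c *\<^sub>C d *\<^sub>C x = (c * d) *\<^sub>C x"
    and scaleC_of_real: "of_real r *\<^sub>C x = r *\<^sub>R x"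
    and cinner_commute: "cinner x y = cnj (cinner y x)"
    and cinner_add_left: "cinner (x + y) w = cinner x w + cinner y w"
    and cinner_scaleC_left: "cinner (c *\<^sub>C x) y = c * cinner x y"
    and Re_cinner: "Re (cinner x y) = inner x y"

class complex_hilbert = complex_inner + complete_space
begin

subclass banach ..

end

instantiation complex :: complex_hilbert
begin

definition scaleC_complex :: "complex \<Rightarrow> complex \<Rightarrow> complex"
  where "scaleC_complex c x = c * x"

definition cinner_complex :: "complex \<Rightarrow> complex \<Rightarrow> complex"
  where "cinner_complex x y = x * cnj y"

instance
  by standard
    (auto simp: scaleC_complex_def cinner_complex_def algebra_simps scaleR_conv_of_real
      inner_complex_def)

end

lemma scaleC_one [simp]: "1 *\<^sub>C x = (x :: 'a::complex_inner)"
  using scaleC_of_real[of 1 x] by simp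

lemma scaleC_zero_left [simp]: "0 *\<^sub>C x = (0 :: 'a::complex_inner)"
  using scaleC_of_real[of 0 x] by simp

lemma scaleC_zero_right [simp]: "c *\<^sub>C 0 = (0 :: 'a::complex_inner)"
  using scaleC_add_right[of c 0 "0 :: 'a"] by simp

lemma cinner_add_right: "cinner x (y + w) = cinner x y + cinner (x :: 'a::complex_inner) w"
  by (metis cinner_add_left cinner_commute complex_cnj_add)

lemma cinner_scaleC_right: "cinner x (c *\<^sub>C y) = cnj c * cinner (x :: 'a::complex_inner) y"
  by (metis cinner_scaleC_left cinner_commute complex_cnj_mult)

lemma cinner_self: "cinner x x = of_real ((norm (x :: 'a::complex_inner))\<^sup>2)"
proof (rule complex_eqI)
  show "Re (cinner x x) = Re (of_real ((norm x)\<^sup>2))"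
    by (simp add: Re_cinner power2_norm_eq_inner)
  have "cinner x x = cnj (cinner x x)"
    by (rule cinner_commute)
  then show "Im (cinner x x) = Im (of_real ((norm x)\<^sup>2))"
    by (metis Im_complex_of_real Reals_cnj_iff complex_is_Real_iff)
qed

lemma norm_scaleC: "norm (c *\<^sub>C x) = cmod c * norm (x :: 'a::complex_inner)"
proof -
  have "complex_of_real ((norm (c *\<^sub>C x))\<^sup>2) = of_real ((cmod c * norm x)\<^sup>2)"
    unfolding cinner_self[symmetric] cinner_scaleC_left cinner_scaleC_right
    by (simp add: cinner_self power_mult_distrib complex_norm_square mult_ac flip: of_real_power)
  then have "(norm (c *\<^sub>C x))\<^sup>2 = (cmod c * norm x)\<^sup>2"
    by (simp only: of_real_eq_iff)
  then show ?thesis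
    by simp
qed

lemma cmod_cinner_le: "cmod (cinner x y) \<le> norm x * norm (y :: 'a::complex_inner)"
proof (cases "cinner x y = 0")
  case False
  define c where "c = cnj (sgn (cinner x y))"
  have "c * cinner x y = of_real (cmod (cinner x y))"
    using False unfolding c_def sgn_div_norm
    by (simp add: scaleR_conv_of_real field_simps complex_norm_square[symmetric]
      power2_eq_square mult.commute)
  then have "cmod (cinner x y) = Re (cinner (c *\<^sub>C x) y)"
    by (simp add: cinner_scaleC_left)
  also have "\<dots> \<le> norm (c *\<^sub>C x) * norm y"
    by (simp add: Re_cinner norm_cauchy_schwarz)
  also have "cmod c = 1"
    using False by (simp add: c_def norm_sgn)
  then have "norm (c *\<^sub>C x) * norm y = norm x * norm y"
    by (simp add: norm_scaleC)
  finally show ?thesis .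
qed simp

lemma bounded_linear_cinner_left: "bounded_linear (\<lambda>x. cinner x (y :: 'a::complex_inner))"
proof
  show "\<exists>K. \<forall>x. cmod (cinner x y) \<le> norm x * K"
    using cmod_cinner_le by blast
  show "cinner (r *\<^sub>R x) y = r *\<^sub>R cinner x y" for r x
    by (metis cinner_scaleC_left scaleC_of_real scaleR_conv_of_real)
qed (rule cinner_add_left)

lemma bounded_linear_scaleC: "bounded_linear (\<lambda>x :: 'a::complex_inner. c *\<^sub>C x)"
proof
  show "\<exists>K. \<forall>x::'a. norm (c *\<^sub>C x) \<le> norm x * K"
    by (metis norm_scaleC mult.commute order_refl)
  show "c *\<^sub>C r *\<^sub>R x = r *\<^sub>R c *\<^sub>C x" for r and x :: 'a
    by (simp add: scaleC_scaleC mult.commute flip: scaleC_of_real)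
qed (rule scaleC_add_right)


section \<open>The Hardy space of a complex Hilbert space\<close>

text \<open>
  Functions on the open unit disc are represented by functions on \<^typ>\<open>complex\<close> that vanish
  outside of it.
\<close>

typedef (overloaded) 'a hardy =
  "{f :: complex \<Rightarrow> 'a::complex_hilbert.
      (\<exists>a. summable (\<lambda>k. (norm (a k))\<^sup>2) \<and> (\<forall>z\<in>ball 0 1. (\<lambda>k. z ^ k *\<^sub>C a k) sums f z)) \<and>
      (\<forall>z. z \<notin> ball 0 1 \<longrightarrow> f z = 0)}"
  morphisms hardy_eval Abs_hardy
  by (intro exI[of _ "\<lambda>_. 0"]) (auto intro!: exI[of _ "\<lambda>_. 0"])

definition hardy_coeff :: "'a::complex_hilbert hardy \<Rightarrow> nat \<Rightarrow> 'a" where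
  "hardy_coeff f = (THE a. summable (\<lambda>k. (norm (a k))\<^sup>2) \<and>
    (\<forall>z\<in>ball 0 1. (\<lambda>k. z ^ k *\<^sub>C a k) sums hardy_eval f z))"

lemma hardy_eq_iff: "f = g \<longleftrightarrow> (\<forall>z\<in>ball 0 1. hardy_eval f z = hardy_eval g z)"
proof
  assume *: "\<forall>z\<in>ball 0 1. hardy_eval f z = hardy_eval g z"
  have "hardy_eval f z = hardy_eval g z" for z
    using * hardy_eval[of f] hardy_eval[of g] by (cases "z \<in> ball 0 1") auto
  then show "f = g"
    by (simp add: hardy_eval_inject[symmetric] fun_eq_iff)
qed simp

lemma complex_power_series_unique:
  fixes a b :: "nat \<Rightarrow> complex"
  assumes "\<forall>z\<in>ball 0 1. (\<lambda>k. a k * z ^ k) sums f z" and "\<forall>z\<in>ball 0 1. (\<lambda>k. b k * z ^ k) sums f z"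
  shows "a = b"
proof -
  have radius: "fps_conv_radius (Abs_fps c) > 0"
    if "\<forall>z\<in>ball 0 1. (\<lambda>k. c k * z ^ k) sums f z" for c
  proof -
    have "summable (\<lambda>k. fps_nth (Abs_fps c) k * (1/2) ^ k)"
      using sums_summable[OF bspec[OF that, of "1/2"]] by simp
    then have "ereal (norm (1/2 :: complex)) \<le> fps_conv_radius (Abs_fps c)"
      unfolding fps_conv_radius_def by (rule conv_radius_geI)
    then show ?thesis
      by (rule less_le_trans[rotated]) simp
  qed
  have "eventually (\<lambda>z::complex. z \<in> ball 0 1) (nhds 0)"
    by (rule eventually_nhds_in_open) auto
  then have "eventually (\<lambda>z. eval_fps (Abs_fps a) z = eval_fps (Abs_fps b) z) (nhds 0)"
    by eventually_elim (use assms in \<open>simp add: eval_fps_def sums_iff\<close>)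
  then have "Abs_fps a = Abs_fps b"
    using radius[OF assms(1)] radius[OF assms(2)] by (intro eval_fps_eqD) auto
  then show ?thesis
    by (simp add: fps_eq_iff fun_eq_iff)
qed

lemma power_series_unique:
  fixes a b :: "nat \<Rightarrow> 'a::complex_inner"
  assumes "\<forall>z\<in>ball 0 1. (\<lambda>k. z ^ k *\<^sub>C a k) sums f z" and "\<forall>z\<in>ball 0 1. (\<lambda>k. z ^ k *\<^sub>C b k) sums f z"
  shows "a = b"
proof
  fix k
  have *: "\<forall>z\<in>ball 0 1. (\<lambda>k. cinner (c k) y * z ^ k) sums cinner (f z) y"
    if "\<forall>z\<in>ball 0 1. (\<lambda>k. z ^ k *\<^sub>C c k) sums f z" for c :: "nat \<Rightarrow> 'a" and y
    using that
    by (auto dest!: bspec bounded_linear.sums[OF bounded_linear_cinner_left[of y]]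
        simp: cinner_scaleC_left mult.commute)
  have "cinner (a k) y = cinner (b k) y" for y
    using complex_power_series_unique[OF *[OF assms(1)] *[OF assms(2)]] by metis
  then have "inner (a k) y = inner (b k) y" for y
    by (simp flip: Re_cinner)
  then have "inner (a k - b k) (a k - b k) = 0"
    by (simp add: inner_diff_left)
  then show "a k = b k"
    by simp
qed

lemma
  shows square_summable_hardy_coeff: "summable (\<lambda>k. (norm (hardy_coeff f k))\<^sup>2)"
    and hardy_eval_sums: "z \<in> ball 0 1 \<Longrightarrow> (\<lambda>k. z ^ k *\<^sub>C hardy_coeff f k) sums hardy_eval f z"
proof -
  let ?P = "\<lambda>a. summable (\<lambda>k. (norm (a k))\<^sup>2) \<and>
    (\<forall>z\<in>ball 0 1. (\<lambda>k. z ^ k *\<^sub>C a k) sums hardy_eval f z)"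
  obtain a where "?P a"
    using hardy_eval[of f] unfolding mem_Collect_eq by (elim conjE exE) (rule that, intro conjI)
  moreover have "b = a" if "?P b" for b
    using conjunct2[OF that] conjunct2[OF \<open>?P a\<close>] by (rule power_series_unique)
  ultimately have *: "?P (hardy_coeff f)"
    unfolding hardy_coeff_def by (rule theI)
  show "summable (\<lambda>k. (norm (hardy_coeff f k))\<^sup>2)"
    by (rule conjunct1[OF *])
  show "(\<lambda>k. z ^ k *\<^sub>C hardy_coeff f k) sums hardy_eval f z" if "z \<in> ball 0 1"
    by (rule bspec[OF conjunct2[OF *] that])
qed

lemma hardy_coeff_unique:
  assumes "\<forall>z\<in>ball 0 1. (\<lambda>k. z ^ k *\<^sub>C a k) sums hardy_eval f z"
  shows "hardy_coeff f = a"
  by (rule power_series_unique[OF _ assms]) (intro ballI hardy_eval_sums)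

lemma hardy_coeff_inject: "hardy_coeff f = hardy_coeff g \<longleftrightarrow> f = g"
proof
  assume *: "hardy_coeff f = hardy_coeff g"
  have "hardy_eval f z = hardy_eval g z" if "z \<in> ball 0 1" for z
    using hardy_eval_sums[OF that, of f] hardy_eval_sums[OF that, of g]
    unfolding * by (rule sums_unique2)
  then show "f = g"
    unfolding hardy_eq_iff by blast
qed simp

lemma summable_mult_of_squares:
  fixes u v :: "nat \<Rightarrow> real"
  assumes "summable (\<lambda>k. (u k)\<^sup>2)" and "summable (\<lambda>k. (v k)\<^sup>2)"
  shows "summable (\<lambda>k. u k * v k)"
proof (rule summable_comparison_test'[OF summable_add[OF assms]])
  show "norm (u k * v k) \<le> (u k)\<^sup>2 + (v k)\<^sup>2" for k
    using sum_squares_bound[of "\<bar>u k\<bar>" "\<bar>v k\<bar>"] abs_ge_zero[of "u k * v k"]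
    unfolding real_norm_def abs_mult power2_abs by linarith
qed

lemma square_summable_add:
  fixes a b :: "nat \<Rightarrow> 'a::real_normed_vector"
  assumes "summable (\<lambda>k. (norm (a k))\<^sup>2)" and "summable (\<lambda>k. (norm (b k))\<^sup>2)"
  shows "summable (\<lambda>k. (norm (a k + b k))\<^sup>2)"
proof (rule summable_comparison_test'[OF summable_mult[OF summable_add[OF assms], of 2]])
  fix k
  have "(norm (a k + b k))\<^sup>2 \<le> (norm (a k) + norm (b k))\<^sup>2"
    by (simp add: norm_triangle_ineq power_mono)
  also have "\<dots> \<le> 2 * ((norm (a k))\<^sup>2 + (norm (b k))\<^sup>2)"
    using sum_squares_bound[of "norm (a k)" "norm (b k)"] by (simp add: power2_sum)
  finally show "norm ((norm (a k + b k))\<^sup>2) \<le> 2 * ((norm (a k))\<^sup>2 + (norm (b k))\<^sup>2)"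
    by simp
qed

lemma square_summable_scaleC:
  fixes a :: "nat \<Rightarrow> 'a::complex_inner"
  assumes "summable (\<lambda>k. (norm (a k))\<^sup>2)"
  shows "summable (\<lambda>k. (norm (c *\<^sub>C a k))\<^sup>2)"
  using summable_mult[OF assms, of "(cmod c)\<^sup>2"] by (simp add: norm_scaleC power_mult_distrib)

lemma square_summable_imp_power_series_summable:
  fixes a :: "nat \<Rightarrow> 'a::complex_hilbert"
  assumes "summable (\<lambda>k. (norm (a k))\<^sup>2)" and "z \<in> ball 0 1"
  shows "summable (\<lambda>k. z ^ k *\<^sub>C a k)"
proof (rule summable_norm_cancel)
  have "(cmod z)\<^sup>2 < 1"
    using assms(2) by (simp add: power_less_one_iff)
  then have "summable (\<lambda>k. ((cmod z)\<^sup>2) ^ k)"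
    by (intro summable_geometric) simp
  then have "summable (\<lambda>k. (cmod z ^ k)\<^sup>2)"
    by (simp flip: power_mult add: mult.commute)
  from summable_mult_of_squares[OF this assms(1)] show "summable (\<lambda>k. norm (z ^ k *\<^sub>C a k))"
    by (simp add: norm_scaleC norm_power)
qed

lemma hardy_of_coeffs:
  fixes a :: "nat \<Rightarrow> 'a::complex_hilbert"
  assumes "summable (\<lambda>k. (norm (a k))\<^sup>2)"
  obtains f where "hardy_coeff f = a"
proof
  let ?f = "\<lambda>z. if z \<in> ball 0 1 then \<Sum>k. z ^ k *\<^sub>C a k else 0"
  have sums: "\<forall>z\<in>ball 0 1. (\<lambda>k. z ^ k *\<^sub>C a k) sums ?f z"
    using square_summable_imp_power_series_summable[OF assms] by (auto intro: summable_sums)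
  then have "hardy_eval (Abs_hardy ?f) = ?f"
    using assms by (intro Abs_hardy_inverse CollectI conjI exI[of _ a]) auto
  with sums show "hardy_coeff (Abs_hardy ?f) = a"
    by (intro hardy_coeff_unique) simp
qed

instantiation hardy :: (complex_hilbert) complex_inner
begin

definition zero_hardy :: "'a hardy"
  where "zero_hardy = Abs_hardy (\<lambda>_. 0)"

definition plus_hardy :: "'a hardy \<Rightarrow> 'a hardy \<Rightarrow> 'a hardy"
  where "plus_hardy f g = Abs_hardy (\<lambda>z. hardy_eval f z + hardy_eval g z)"

definition scaleC_hardy :: "complex \<Rightarrow> 'a hardy \<Rightarrow> 'a hardy"
  where "scaleC_hardy c f = Abs_hardy (\<lambda>z. c *\<^sub>C hardy_eval f z)"

definition scaleR_hardy :: "real \<Rightarrow> 'a hardy \<Rightarrow> 'a hardy"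
  where "scaleR_hardy r f = of_real r *\<^sub>C f"

definition uminus_hardy :: "'a hardy \<Rightarrow> 'a hardy"
  where "uminus_hardy f = (- 1) *\<^sub>C f"

definition minus_hardy :: "'a hardy \<Rightarrow> 'a hardy \<Rightarrow> 'a hardy"
  where "minus_hardy f g = f + - g"

definition cinner_hardy :: "'a hardy \<Rightarrow> 'a hardy \<Rightarrow> complex"
  where "cinner_hardy f g = (\<Sum>k. cinner (hardy_coeff f k) (hardy_coeff g k))"

definition inner_hardy :: "'a hardy \<Rightarrow> 'a hardy \<Rightarrow> real"
  where "inner_hardy f g = Re (cinner f g)"

definition norm_hardy :: "'a hardy \<Rightarrow> real"
  where "norm_hardy f = sqrt (inner f f)"

definition sgn_hardy :: "'a hardy \<Rightarrow> 'a hardy"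
  where "sgn_hardy f = inverse (norm f) *\<^sub>R f"

definition dist_hardy :: "'a hardy \<Rightarrow> 'a hardy \<Rightarrow> real"
  where "dist_hardy f g = norm (f - g)"

definition uniformity_hardy :: "('a hardy \<times> 'a hardy) filter"
  where "uniformity_hardy = (INF e\<in>{0 <..}. principal {(f, g). dist f g < e})"

definition open_hardy :: "'a hardy set \<Rightarrow> bool"
  where "open_hardy S = (\<forall>f\<in>S. \<forall>\<^sub>F (f', g) in uniformity. f' = f \<longrightarrow> g \<in> S)"

lemma hardy_eval_zero: "hardy_eval 0 z = (0 :: 'a)"
  unfolding zero_hardy_def
  by (subst Abs_hardy_inverse) (auto intro!: exI[of _ "\<lambda>_. 0"])

lemma hardy_eval_plus: "hardy_eval (f + g :: 'a hardy) z = hardy_eval f z + hardy_eval g z"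
  unfolding plus_hardy_def
proof (subst Abs_hardy_inverse, safe)
  show "\<exists>a. summable (\<lambda>k. (norm (a k))\<^sup>2) \<and>
    (\<forall>z\<in>ball 0 1. (\<lambda>k. z ^ k *\<^sub>C a k) sums (hardy_eval f z + hardy_eval g z))"
    by (intro exI[of _ "\<lambda>k. hardy_coeff f k + hardy_coeff g k"])
      (auto simp del: mem_ball simp: scaleC_add_right
        intro!: square_summable_add square_summable_hardy_coeff sums_add hardy_eval_sums)
qed (use hardy_eval[of f] hardy_eval[of g] in auto)

lemma hardy_eval_scaleC: "hardy_eval (c *\<^sub>C f :: 'a hardy) z = c *\<^sub>C hardy_eval f z"
  unfolding scaleC_hardy_def
proof (subst Abs_hardy_inverse, safe)
  have "(\<lambda>k. z ^ k *\<^sub>C c *\<^sub>C hardy_coeff f k) sums (c *\<^sub>C hardy_eval f z)" if "z \<in> ball 0 1" for z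
    using bounded_linear.sums[OF bounded_linear_scaleC hardy_eval_sums[OF that]]
    by (simp add: scaleC_scaleC mult.commute)
  then show "\<exists>a. summable (\<lambda>k. (norm (a k))\<^sup>2) \<and>
    (\<forall>z\<in>ball 0 1. (\<lambda>k. z ^ k *\<^sub>C a k) sums (c *\<^sub>C hardy_eval f z))"
    by (intro exI[of _ "\<lambda>k. c *\<^sub>C hardy_coeff f k"])
      (auto simp del: mem_ball intro!: square_summable_scaleC square_summable_hardy_coeff)
qed (use hardy_eval[of f] in auto)

lemma hardy_coeff_zero: "hardy_coeff (0 :: 'a hardy) k = 0"
  by (subst hardy_coeff_unique[of "\<lambda>_. 0"]) (auto simp: hardy_eval_zero)

lemma hardy_coeff_plus: "hardy_coeff (f + g :: 'a hardy) k = hardy_coeff f k + hardy_coeff g k"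
  by (subst hardy_coeff_unique[of "\<lambda>k. hardy_coeff f k + hardy_coeff g k"])
    (auto simp del: mem_ball simp: hardy_eval_plus scaleC_add_right
      intro!: sums_add hardy_eval_sums)

lemma hardy_coeff_scaleC: "hardy_coeff (c *\<^sub>C f :: 'a hardy) k = c *\<^sub>C hardy_coeff f k"
proof (subst hardy_coeff_unique[of "\<lambda>k. c *\<^sub>C hardy_coeff f k"], safe)
  fix z :: complex assume "z \<in> ball 0 1"
  from bounded_linear.sums[OF bounded_linear_scaleC hardy_eval_sums[OF this]]
  show "(\<lambda>k. z ^ k *\<^sub>C c *\<^sub>C hardy_coeff f k) sums hardy_eval (c *\<^sub>C f) z"
    by (simp add: hardy_eval_scaleC scaleC_scaleC mult.commute)
qed

lemma cinner_hardy_sums: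
  "(\<lambda>k. cinner (hardy_coeff f k) (hardy_coeff g k)) sums cinner f (g :: 'a hardy)"
  unfolding cinner_hardy_def
proof (rule summable_sums, rule summable_norm_cancel)
  show "summable (\<lambda>k. cmod (cinner (hardy_coeff f k) (hardy_coeff g k)))"
    by (rule summable_comparison_test'[OF summable_mult_of_squares[OF
            square_summable_hardy_coeff[of f] square_summable_hardy_coeff[of g]]])
      (simp add: cmod_cinner_le)
qed

lemma norm_hardy_sums: "(\<lambda>k. (norm (hardy_coeff f k))\<^sup>2) sums ((norm (f :: 'a hardy))\<^sup>2)"
proof -
  have sums: "(\<lambda>k. (norm (hardy_coeff f k))\<^sup>2) sums Re (cinner f f)"
    using sums_Re[OF cinner_hardy_sums[of f f]] by (simp add: cinner_self)
  then have "Re (cinner f f) \<ge> 0"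
    by (rule sums_le[OF _ sums_zero, rotated]) simp
  with sums show ?thesis
    by (simp add: norm_hardy_def inner_hardy_def)
qed

instance
proof
  fix f g h :: "'a hardy" and c d :: complex and r s :: real
  note defs = uminus_hardy_def minus_hardy_def scaleR_hardy_def hardy_coeff_inject[symmetric]
    fun_eq_iff hardy_coeff_zero hardy_coeff_plus hardy_coeff_scaleC scaleC_add_right
    scaleC_add_left scaleC_scaleC
  show "f + g + h = f + (g + h)" "f + g = g + f" "0 + f = f"
    by (simp_all add: defs algebra_simps)
  show "- f + f = 0"
  proof -
    have "(- 1) *\<^sub>C x + x = 0" for x :: 'a
      using scaleC_add_left[of "- 1" 1 x] by simp
    then show ?thesis
      by (simp add: defs)
  qed
  show "f - g = f + - g"
    by (simp add: minus_hardy_def)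
  show "r *\<^sub>R (f + g) = r *\<^sub>R f + r *\<^sub>R g" "(r + s) *\<^sub>R f = r *\<^sub>R f + s *\<^sub>R f"
    "r *\<^sub>R s *\<^sub>R f = (r * s) *\<^sub>R f" "1 *\<^sub>R f = f"
    by (simp_all add: defs)
  show "sgn f = inverse (norm f) *\<^sub>R f" "dist f g = norm (f - g)"
    by (simp_all add: sgn_hardy_def dist_hardy_def)
  show "(uniformity :: ('a hardy \<times> 'a hardy) filter) = (INF e\<in>{0 <..}. principal {(f, g). dist f g < e})"
    by (rule uniformity_hardy_def)
  show "open S = (\<forall>f\<in>S. \<forall>\<^sub>F (f', g) in uniformity. f' = f \<longrightarrow> g \<in> S)" for S :: "'a hardy set"
    by (rule open_hardy_def)
  show scaleC: "c *\<^sub>C (f + g) = c *\<^sub>C f + c *\<^sub>C g" "(c + d) *\<^sub>C f = c *\<^sub>C f + d *\<^sub>C f"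
    "c *\<^sub>C d *\<^sub>C f = (c * d) *\<^sub>C f" "of_real r *\<^sub>C f = r *\<^sub>R f"
    by (simp_all add: defs)
  show add_left: "cinner (f + g) h = cinner f h + cinner g h"
    using sums_add[OF cinner_hardy_sums[of f h] cinner_hardy_sums[of g h]]
    by (intro sums_unique2[OF cinner_hardy_sums])
      (simp add: hardy_coeff_plus cinner_add_left)
  show scale_left: "cinner (c *\<^sub>C f) g = c * cinner f g" for c
    using sums_mult[OF cinner_hardy_sums[of f g], of c]
    by (intro sums_unique2[OF cinner_hardy_sums])
      (simp add: hardy_coeff_scaleC cinner_scaleC_left)
  show commute: "cinner f g = cnj (cinner g f)"
    by (rule sums_unique2[OF cinner_hardy_sums])
      (use cinner_hardy_sums[of g f] in \<open>subst cinner_commute, simp add: sums_cnj\<close>)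
  show "Re (cinner f g) = inner f g"
    by (simp add: inner_hardy_def)
  show "inner f g = inner g f"
    using commute by (simp add: inner_hardy_def)
  show "inner (f + g) h = inner f h + inner g h"
    using add_left by (simp add: inner_hardy_def)
  show "inner (r *\<^sub>R f) g = r * inner f g"
    using scale_left by (simp add: inner_hardy_def scaleR_hardy_def)
  have sums: "(\<lambda>k. (norm (hardy_coeff f k))\<^sup>2) sums inner f f"
    using sums_Re[OF cinner_hardy_sums[of f f]] by (simp add: cinner_self inner_hardy_def)
  then show "0 \<le> inner f f"
    by (rule sums_le[OF _ sums_zero, rotated]) simp
  show "inner f f = 0 \<longleftrightarrow> f = 0"
  proof
    assume "inner f f = 0"
    then have "\<forall>k. (norm (hardy_coeff f k))\<^sup>2 = 0"
      using sums by (subst suminf_eq_zero_iff[symmetric]) (auto simp: sums_iff)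
    then show "f = 0"
      by (simp add: defs)
  next
    assume "f = 0"
    then show "inner f f = 0"
      using sums_unique2[OF sums] by (simp add: hardy_coeff_zero)
  qed
  show "norm f = sqrt (inner f f)"
    by (rule norm_hardy_def)
qed

end

lemma hardy_eval_minus: "hardy_eval (f - g) z = hardy_eval f z - hardy_eval g z"
  by (metis add_diff_cancel diff_add_cancel hardy_eval_plus)

lemma hardy_coeff_minus: "hardy_coeff (f - g) k = hardy_coeff f k - hardy_coeff g k"
  by (metis add_diff_cancel diff_add_cancel hardy_coeff_plus)

lemma norm_hardy_coeff_le: "norm (hardy_coeff f k) \<le> norm f"
proof -
  have "(\<Sum>i\<in>{k}. (norm (hardy_coeff f i))\<^sup>2) \<le> (\<Sum>i. (norm (hardy_coeff f i))\<^sup>2)"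
    by (rule sum_le_suminf[OF square_summable_hardy_coeff]) auto
  then have "(norm (hardy_coeff f k))\<^sup>2 \<le> (norm f)\<^sup>2"
    using norm_hardy_sums[of f] by (simp add: sums_iff)
  then show ?thesis
    by (simp add: power2_le_iff_abs_le)
qed

instance hardy :: (complex_hilbert) complex_hilbert
proof
  fix X :: "nat \<Rightarrow> 'a hardy"
  assume X: "Cauchy X"
  have "Cauchy (\<lambda>n. hardy_coeff (X n) k)" for k
  proof (rule metric_CauchyI)
    fix e :: real assume "e > 0"
    with X obtain N where "\<forall>m\<ge>N. \<forall>n\<ge>N. dist (X m) (X n) < e"
      by (meson metric_CauchyD)
    then show "\<exists>N. \<forall>m\<ge>N. \<forall>n\<ge>N. dist (hardy_coeff (X m) k) (hardy_coeff (X n) k) < e"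
      by (metis dist_norm hardy_coeff_minus norm_hardy_coeff_le order_le_less_trans)
  qed
  then have "\<exists>l. (\<lambda>n. hardy_coeff (X n) k) \<longlonglongrightarrow> l" for k
    using Cauchy_convergent convergent_def by blast
  then obtain a where a: "\<And>k. (\<lambda>n. hardy_coeff (X n) k) \<longlonglongrightarrow> a k"
    by metis
  have tail: "\<exists>N. \<forall>m\<ge>N. \<forall>K. (\<Sum>k<K. (norm (hardy_coeff (X m) k - a k))\<^sup>2) \<le> e\<^sup>2"
    if "e > 0" for e
  proof -
    from X that obtain N where N: "\<forall>m\<ge>N. \<forall>n\<ge>N. dist (X m) (X n) < e"
      by (meson metric_CauchyD)
    have "(\<Sum>k<K. (norm (hardy_coeff (X m) k - a k))\<^sup>2) \<le> e\<^sup>2" if "m \<ge> N" for m K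
    proof (rule tendsto_upperbound)
      show "(\<lambda>n. \<Sum>k<K. (norm (hardy_coeff (X m) k - hardy_coeff (X n) k))\<^sup>2)
        \<longlonglongrightarrow> (\<Sum>k<K. (norm (hardy_coeff (X m) k - a k))\<^sup>2)"
        by (intro tendsto_intros a)
      have "(\<Sum>k<K. (norm (hardy_coeff (X m) k - hardy_coeff (X n) k))\<^sup>2) \<le> e\<^sup>2" if "n \<ge> N" for n
      proof -
        have "(\<Sum>k<K. (norm (hardy_coeff (X m - X n) k))\<^sup>2) \<le> (norm (X m - X n))\<^sup>2"
          using norm_hardy_sums[of "X m - X n"] square_summable_hardy_coeff[of "X m - X n"]
          by (metis sum_le_suminf finite_lessThan sums_unique zero_le_power2)
        also have "\<dots> \<le> e\<^sup>2"
          using N \<open>m \<ge> N\<close> that by (auto simp: dist_norm less_imp_le intro!: power_mono)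
        finally show ?thesis
          by (simp add: hardy_coeff_minus)
      qed
      then show "\<forall>\<^sub>F n in sequentially.
          (\<Sum>k<K. (norm (hardy_coeff (X m) k - hardy_coeff (X n) k))\<^sup>2) \<le> e\<^sup>2"
        by (auto simp: eventually_sequentially)
    qed simp
    then show ?thesis
      by blast
  qed
  have diff: "summable (\<lambda>k. (norm (hardy_coeff (X m) k - a k))\<^sup>2)"
    if "\<forall>K. (\<Sum>k<K. (norm (hardy_coeff (X m) k - a k))\<^sup>2) \<le> e" for m e
    by (rule bounded_imp_summable[of _ e]) (use that in \<open>auto simp: lessThan_Suc_atMost[symmetric] simp del: sum.lessThan_Suc\<close>)
  obtain M where M: "summable (\<lambda>k. (norm (hardy_coeff (X M) k - a k))\<^sup>2)"
    using tail[OF zero_less_one] diff by (blast intro: order_refl)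
  have "summable (\<lambda>k. (norm ((a k - hardy_coeff (X M) k) + hardy_coeff (X M) k))\<^sup>2)"
    by (rule square_summable_add) (use M square_summable_hardy_coeff in \<open>auto simp: norm_minus_commute\<close>)
  then have "summable (\<lambda>k. (norm (a k))\<^sup>2)"
    by simp
  then obtain f where f: "hardy_coeff f = a"
    by (rule hardy_of_coeffs)
  have "X \<longlonglongrightarrow> f"
  proof (rule metric_LIMSEQ_I)
    fix r :: real assume "r > 0"
    then obtain N where N: "\<forall>m\<ge>N. \<forall>K. (\<Sum>k<K. (norm (hardy_coeff (X m) k - a k))\<^sup>2) \<le> (r / 2)\<^sup>2"
      using tail[of "r / 2"] by auto
    have "dist (X m) f < r" if "m \<ge> N" for m
    proof -
      have bound: "\<forall>K. (\<Sum>k<K. (norm (hardy_coeff (X m) k - a k))\<^sup>2) \<le> (r / 2)\<^sup>2"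
        using N that by blast
      have "(norm (X m - f))\<^sup>2 = (\<Sum>k. (norm (hardy_coeff (X m) k - a k))\<^sup>2)"
        using sums_unique[OF norm_hardy_sums[of "X m - f"]] by (simp add: hardy_coeff_minus f)
      also have "\<dots> \<le> (r / 2)\<^sup>2"
        using diff[OF bound] bound by (intro suminf_le_const) auto
      finally have "(norm (X m - f))\<^sup>2 \<le> (r / 2)\<^sup>2" .
      then have "norm (X m - f) \<le> r / 2"
        using \<open>r > 0\<close> by (simp add: power2_le_iff_abs_le)
      then show ?thesis
        using \<open>r > 0\<close> by (simp add: dist_norm)
    qed
    then show "\<exists>N. \<forall>m\<ge>N. dist (X m) f < r"
      by blast
  qed
  then show "convergent X"
    by (rule convergentI)
qed


text \<open>The space of the elements of the Hardy space with values in a closed subspace \<open>E\<close>.\<close>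

definition hardy_space :: "'a::complex_hilbert set \<Rightarrow> 'a hardy set" where
  "hardy_space E = {f. \<forall>z\<in>ball 0 1. hardy_eval f z \<in> E}"

text \<open>
  Multiplication by \<open>\<phi>\<close>; meaningful only at those \<open>f\<close> for which \<open>z \<mapsto> \<phi> z (f z)\<close> again belongs to
  the Hardy space.  For \<open>f\<close> in \<^term>\<open>hardy_space E\<close> only the values of \<open>\<phi> z\<close> on \<open>E\<close> matter.
\<close>

definition mult_op :: "(complex \<Rightarrow> 'a \<Rightarrow> 'a) \<Rightarrow> 'a hardy \<Rightarrow> 'a::complex_hilbert hardy" where
  "mult_op \<phi> f = (THE g. \<forall>z\<in>ball 0 1. hardy_eval g z = \<phi> z (hardy_eval f z))"


section \<open>Operators\<close>

text \<open>
  Operators on a closed subspace \<open>E\<close> are represented by functions on the whole type, whose values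
  outside of \<open>E\<close> are irrelevant.
\<close>

definition bounded_op ::
    "'a::complex_inner set \<Rightarrow> 'b::complex_inner set \<Rightarrow> ('a \<Rightarrow> 'b) \<Rightarrow> bool" where
  "bounded_op E F A \<longleftrightarrow> A ` E \<subseteq> F \<and>
    (\<forall>x\<in>E. \<forall>y\<in>E. A (x + y) = A x + A y) \<and> (\<forall>c. \<forall>x\<in>E. A (c *\<^sub>C x) = c *\<^sub>C A x) \<and>
    (\<exists>K. \<forall>x\<in>E. norm (A x) \<le> K * norm x)"

definition adj_on :: "'a::complex_inner set \<Rightarrow> ('a \<Rightarrow> 'b::complex_inner) \<Rightarrow> 'b \<Rightarrow> 'a" where
  "adj_on E A y = (THE x. x \<in> E \<and> (\<forall>u\<in>E. cinner (A u) y = cinner u x))"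

abbreviation adj :: "('a::complex_inner \<Rightarrow> 'b::complex_inner) \<Rightarrow> 'b \<Rightarrow> 'a" where
  "adj \<equiv> adj_on UNIV"

definition projection_on :: "'a::complex_inner set \<Rightarrow> ('a \<Rightarrow> 'a) \<Rightarrow> bool" where
  "projection_on E P \<longleftrightarrow> bounded_op E E P \<and> (\<forall>x\<in>E. P (P x) = P x) \<and>
    (\<forall>x\<in>E. \<forall>y\<in>E. cinner (P x) y = cinner x (P y))"

definition perp :: "('a \<Rightarrow> 'a) \<Rightarrow> 'a \<Rightarrow> 'a::complex_inner" where
  "perp P x = x - P x"

definition orth_proj :: "'a::complex_inner set \<Rightarrow> 'a \<Rightarrow> 'a" where
  "orth_proj M x = (THE y. y \<in> M \<and> (\<forall>u\<in>M. cinner (x - y) u = 0))"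

definition unitary_between ::
    "'a::complex_inner set \<Rightarrow> 'b::complex_inner set \<Rightarrow> ('a \<Rightarrow> 'b) \<Rightarrow> bool" where
  "unitary_between E F V \<longleftrightarrow> bounded_op E F V \<and> V ` E = F \<and>
    (\<forall>x\<in>E. \<forall>y\<in>E. cinner (V x) (V y) = cinner x y)"

definition unitarily_equivalent ::
    "nat \<Rightarrow> 'a::complex_inner set \<Rightarrow> (nat \<Rightarrow> 'a \<Rightarrow> 'a) \<Rightarrow>
      'b::complex_inner set \<Rightarrow> (nat \<Rightarrow> 'b \<Rightarrow> 'b) \<Rightarrow> bool" where
  "unitarily_equivalent n E A F B \<longleftrightarrow>
    (\<exists>V. unitary_between E F V \<and> (\<forall>i\<in>{1..n}. \<forall>x\<in>E. V (A i x) = B i (V x)))"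

definition op_prod :: "nat \<Rightarrow> (nat \<Rightarrow> 'a \<Rightarrow> 'a) \<Rightarrow> 'a \<Rightarrow> 'a" where
  "op_prod n A = foldr (\<lambda>i B. A i \<circ> B) [1..<Suc n] id"

definition contraction :: "('a::complex_hilbert \<Rightarrow> 'a) \<Rightarrow> bool" where
  "contraction T \<longleftrightarrow> bounded_op UNIV UNIV T \<and> onorm T \<le> 1"

definition C_dot_0_contraction :: "('a::complex_hilbert \<Rightarrow> 'a) \<Rightarrow> bool" where
  "C_dot_0_contraction T \<longleftrightarrow> contraction T \<and> (\<forall>x. (\<lambda>k. (adj T ^^ k) x) \<longlonglongrightarrow> 0)"


section \<open>Defect operators, characteristic function and model space of a contraction\<close>

definition positive_op :: "('a::complex_hilbert \<Rightarrow> 'a) \<Rightarrow> bool" where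
  "positive_op A \<longleftrightarrow> bounded_op UNIV UNIV A \<and> (\<forall>x. cinner (A x) x \<in> \<real>\<^sub>\<ge>\<^sub>0)"

definition pos_sqrt :: "('a::complex_hilbert \<Rightarrow> 'a) \<Rightarrow> 'a \<Rightarrow> 'a" where
  "pos_sqrt A = (THE S. positive_op S \<and> S \<circ> S = A)"

text \<open>
  The defect operator \<open>D\<^sub>T\<close>.  Its companion \<open>D\<^sub>T\<^sub>*\<close> is \<^term>\<open>defect_op (adj T)\<close>, which is the
  positive square root of \<open>I - T T\<^sup>*\<close> since the adjoint of \<open>T\<^sup>*\<close> is \<open>T\<close>.
\<close>

definition defect_op :: "('a::complex_hilbert \<Rightarrow> 'a) \<Rightarrow> 'a \<Rightarrow> 'a" where
  "defect_op T = pos_sqrt (\<lambda>x. x - adj T (T x))"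

definition defect_space :: "('a::complex_hilbert \<Rightarrow> 'a) \<Rightarrow> 'a set" where
  "defect_space T = closure (range (defect_op T))"

text \<open>
  The restriction to the defect space of \<open>T\<close> is implicit: the characteristic function is applied
  only to elements of that space.
\<close>

definition char_fun :: "('a::complex_hilbert \<Rightarrow> 'a) \<Rightarrow> complex \<Rightarrow> 'a \<Rightarrow> 'a" where
  "char_fun T z x =
    - T x + z *\<^sub>C defect_op (adj T) (inv (\<lambda>y. y - z *\<^sub>C adj T y) (defect_op T x))"

definition model_space :: "('a::complex_hilbert \<Rightarrow> 'a) \<Rightarrow> 'a hardy set" where
  "model_space T = {f \<in> hardy_space (defect_space (adj T)).
    \<forall>g \<in> mult_op (char_fun T) ` hardy_space (defect_space T). cinner f g = 0}"

end

theory Submission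
  imports Defs
begin

text \<open>
  Write \<open>S = T\<^sup>*\<close> and let \<open>D\<close> be the defect operator of \<open>T\<^sup>*\<close>.  The unitary is the embedding
  \<open>V h = \<Sum>\<^sub>k z\<^sup>k D S\<^sup>k h\<close>.  Since \<open>D\<^sup>2 = I - T S\<close>, the squared norms of its coefficients telescope to
  \<open>\<parallel>h\<parallel>\<^sup>2 - lim \<parallel>S\<^sup>k h\<parallel>\<^sup>2\<close>, and the limit is \<open>0\<close> because \<open>T\<close> is \<open>C\<^sub>\<cdot>\<^sub>0\<close>: thus \<open>V\<close> is isometric.

  That the range of \<open>V\<close> is the model space (\<open>unitary_between_model_embedding\<close>) rests on reading
  the characteristic function as the transfer function of the system \<open>x' = S x + D\<^sub>T u\<close>,
  \<open>y = D x - T u\<close>, whose colligation matrix is unitary because \<open>T D\<^sub>T = D T\<close>.  Conservation of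
  energy shows that multiplication by the characteristic function maps square summable inputs to
  square summable outputs (\<open>hardy_coeff_mult_char_fun\<close>).  Running the adjoint system backwards
  along the coefficients of a function \<open>f\<close> computes its pairings with those outputs
  (\<open>mult_char_fun_pairing\<close>): all of them vanish when \<open>f = V h\<close>, and conversely, when they vanish,
  unitarity of the colligation forces the backward states to satisfy \<open>a\<^sub>k = S\<^sup>k a\<^sub>0\<close> and the coefficients
  of \<open>f\<close> to be \<open>D a\<^sub>k\<close>, that is, \<open>f = V a\<^sub>0\<close>.

  Finally, each \<open>T\<^sub>i\<close> commutes with the product \<open>T\<close>, so the factorisation hypothesis
  \<open>D T\<^sub>i\<^sup>* = P\<^sub>i\<^sup>\<bottom> U\<^sub>i\<^sup>* D + P\<^sub>i U\<^sub>i\<^sup>* D T\<^sup>*\<close>, applied to the vectors \<open>S\<^sup>k h\<close>, says that the adjoint of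
  multiplication by \<open>U\<^sub>i P\<^sub>i\<^sup>\<bottom> + z U\<^sub>i P\<^sub>i\<close> maps \<open>V h\<close> to \<open>V T\<^sub>i\<^sup>* h\<close>.  Taking adjoints, the compression of this
  multiplication operator to the range of \<open>V\<close> is \<open>V T\<^sub>i V\<^sup>*\<close> (\<open>model_embedding_compression\<close>).

  Two ingredients precede this: the existence of adjoints, from the Riesz representation
  theorem, and the existence and uniqueness of positive square roots together with the
  intertwining relation \<open>T D\<^sub>T = D T\<close>, from an approximation of the square root by polynomials.
\<close>

section \<open>Inner products and adjoints\<close>

lemma scaleC_minus_one [simp]: "(- 1) *\<^sub>C x = - (x :: 'a::complex_inner)"
  using scaleC_of_real[of "- 1" x] by simp

lemma scaleC_minus_right: "c *\<^sub>C (- x) = - (c *\<^sub>C (x :: 'a::complex_inner))"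
  by (metis mult.commute scaleC_minus_one scaleC_scaleC)

lemma scaleC_diff_right: "c *\<^sub>C (x - y) = c *\<^sub>C x - c *\<^sub>C (y :: 'a::complex_inner)"
  using scaleC_add_right[of c x "- y"] by (simp add: scaleC_minus_right)

lemma bounded_linear_cinner_right: "bounded_linear (\<lambda>y. cinner (x :: 'a::complex_inner) y)"
  by (subst cinner_commute)
    (rule bounded_linear_compose[OF bounded_linear_cnj bounded_linear_cinner_left])

lemmas cinner_zero_left [simp] = linear_0[OF bounded_linear.linear[OF bounded_linear_cinner_left]]
lemmas cinner_zero_right [simp] = linear_0[OF bounded_linear.linear[OF bounded_linear_cinner_right]]
lemmas cinner_diff_left = linear_diff[OF bounded_linear.linear[OF bounded_linear_cinner_left]]
lemmas cinner_diff_right = linear_diff[OF bounded_linear.linear[OF bounded_linear_cinner_right]]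

lemma cinner_self_eq_0 [simp]: "cinner x x = 0 \<longleftrightarrow> x = (0 :: 'a::complex_inner)"
  by (simp add: cinner_self)

lemma cinner_eqI:
  fixes x y :: "'a::complex_inner"
  assumes "\<And>u. cinner u x = cinner u y"
  shows "x = y"
  using assms[of "x - y"] by (metis cinner_diff_right cinner_self_eq_0 eq_iff_diff_eq_0)

lemma bounded_op_add: "bounded_op E F A \<Longrightarrow> x \<in> E \<Longrightarrow> y \<in> E \<Longrightarrow> A (x + y) = A x + A y"
  and bounded_op_scaleC: "bounded_op E F A \<Longrightarrow> x \<in> E \<Longrightarrow> A (c *\<^sub>C x) = c *\<^sub>C A x"
  and bounded_op_mem: "bounded_op E F A \<Longrightarrow> x \<in> E \<Longrightarrow> A x \<in> F"
  unfolding bounded_op_def by blast+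

lemma bounded_op_imp_bounded_linear:
  assumes "bounded_op UNIV F A"
  shows "bounded_linear A"
proof -
  obtain K where "\<forall>x. norm (A x) \<le> K * norm x"
    using assms unfolding bounded_op_def by blast
  then show ?thesis
    using bounded_op_add[OF assms] bounded_op_scaleC[OF assms, of _ "of_real _"]
    by (intro bounded_linear_intro[of A K]) (auto simp: scaleC_of_real mult.commute)
qed

lemma bounded_op_UNIV_iff:
  "bounded_op UNIV UNIV A \<longleftrightarrow> bounded_linear A \<and> (\<forall>c x. A (c *\<^sub>C x) = c *\<^sub>C A x)"
proof safe
  assume "bounded_linear A" and "\<forall>c x. A (c *\<^sub>C x) = c *\<^sub>C A x"
  then show "bounded_op UNIV UNIV A"
    unfolding bounded_op_def
    using bounded_linear.bounded[of A]
    by (auto simp: linear_add bounded_linear.linear mult.commute)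
qed (auto intro: bounded_op_imp_bounded_linear bounded_op_scaleC)

text \<open>
  The representing vector minimises \<open>\<parallel>x\<parallel>\<^sup>2 - 2 f x\<close>: a minimising sequence is Cauchy by the
  parallelogram law, and at the minimum no step in any direction lowers the value.
\<close>

lemma riesz_representation_real:
  fixes f :: "'a::{real_inner, complete_space} \<Rightarrow> real"
  assumes "bounded_linear f"
  obtains y where "\<And>x. f x = inner x y"
proof -
  interpret f: bounded_linear f by fact
  obtain K where K: "\<And>x. \<bar>f x\<bar> \<le> norm x * K"
    using f.bounded by auto
  define J where "J x = (norm x)\<^sup>2 - 2 * f x" for x
  define m where "m = Inf (range J)"
  have "J x \<ge> - K\<^sup>2" for x
  proof -
    have "0 \<le> (norm x - K)\<^sup>2"
      by simp
    also have "\<dots> = (norm x)\<^sup>2 - 2 * (norm x * K) + K\<^sup>2"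
      by (simp add: power2_diff)
    finally show ?thesis
      using K[of x] by (simp add: J_def)
  qed
  then have bdd: "bdd_below (range J)"
    by (auto simp: bdd_below_def)
  then have m_le: "m \<le> J x" for x
    unfolding m_def by (simp add: cInf_lower)
  have "\<exists>x. J x < m + e" if "e > 0" for e
    using cInf_lessD[of "range J" "m + e"] that by (auto simp: m_def)
  then have "\<exists>x. J x < m + inverse (Suc n)" for n
    by simp
  then obtain X where X: "\<And>n. J (X n) < m + inverse (Suc n)"
    by metis
  have parallelogram: "(norm (x - y))\<^sup>2 \<le> 2 * (J x - m) + 2 * (J y - m)" for x y
  proof -
    have "(norm (x - y))\<^sup>2 = 2 * J x + 2 * J y - 4 * J ((1/2) *\<^sub>R (x + y))"
      by (simp add: J_def power2_norm_eq_inner f.add f.scale inner_left_distrib inner_right_distrib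
          inner_diff_left inner_diff_right inner_commute algebra_simps)
    then show ?thesis
      using m_le[of "(1/2) *\<^sub>R (x + y)"] by simp
  qed
  have "Cauchy X"
  proof (rule metric_CauchyI)
    fix e :: real assume "e > 0"
    then obtain N where N: "inverse (real (Suc N)) < e\<^sup>2 / 4"
      using reals_Archimedean[of "e\<^sup>2 / 4"] by auto
    have small: "J (X k) - m < e\<^sup>2 / 4" if "k \<ge> N" for k
    proof -
      have "inverse (real (Suc k)) \<le> inverse (real (Suc N))"
        using that by (simp add: field_simps)
      then show ?thesis
        using X[of k] N by linarith
    qed
    have "dist (X i) (X j) < e" if "i \<ge> N" "j \<ge> N" for i j
    proof -
      have "(norm (X i - X j))\<^sup>2 < e\<^sup>2"
        using parallelogram[of "X i" "X j"] small[OF that(1)] small[OF that(2)] by simp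
      then show ?thesis
        using \<open>e > 0\<close> by (simp add: dist_norm power_less_imp_less_base)
    qed
    then show "\<exists>M. \<forall>i\<ge>M. \<forall>j\<ge>M. dist (X i) (X j) < e"
      by blast
  qed
  then obtain y where y: "X \<longlonglongrightarrow> y"
    using Cauchy_convergent convergent_def by blast
  have "(\<lambda>n. J (X n)) \<longlonglongrightarrow> J y"
    unfolding J_def by (intro tendsto_intros y f.tendsto)
  moreover have "(\<lambda>n. m + inverse (real (Suc n))) \<longlonglongrightarrow> m + 0"
    by (intro tendsto_intros LIMSEQ_inverse_real_of_nat)
  ultimately have "J y \<le> m + 0"
    using X by (intro LIMSEQ_le) (auto intro: less_imp_le)
  then have min: "J y \<le> J x" for x
    using m_le[of x] by simp
  have "f x = inner x y" for x
  proof (cases "x = 0")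
    case False
    \<comment> \<open>The step from the minimum that makes the quadratic polynomial in the step length smallest.\<close>
    define t where "t = (f x - inner x y) / (norm x)\<^sup>2"
    have "J (y + t *\<^sub>R x) = J y + t\<^sup>2 * (norm x)\<^sup>2 - 2 * t * (f x - inner x y)"
      unfolding J_def power2_norm_eq_inner
      by (simp add: f.add f.scale inner_left_distrib inner_right_distrib inner_commute
          power2_eq_square algebra_simps)
    also have "\<dots> = J y - (f x - inner x y)\<^sup>2 / (norm x)\<^sup>2"
      using False by (simp add: t_def field_simps power2_eq_square)
    finally have "(f x - inner x y)\<^sup>2 / (norm x)\<^sup>2 \<le> 0"
      using min[of "y + t *\<^sub>R x"] by simp
    then show ?thesis
      using False by (simp add: divide_le_0_iff)
  qed (simp add: f.zero)
  then show thesis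
    by (rule that)
qed

lemma adj_on_eqI:
  assumes "x \<in> E" and "\<And>u. u \<in> E \<Longrightarrow> cinner (A u) y = cinner u x"
    and "\<And>u v. u \<in> E \<Longrightarrow> v \<in> E \<Longrightarrow> u - v \<in> E"
  shows "adj_on E A y = x"
  unfolding adj_on_def
proof (rule the_equality)
  fix x' assume x': "x' \<in> E \<and> (\<forall>u\<in>E. cinner (A u) y = cinner u x')"
  then have "cinner (x' - x) x' = cinner (x' - x) x"
    using assms by metis
  then show "x' = x"
    by (metis cinner_diff_right cinner_self_eq_0 eq_iff_diff_eq_0)
qed (use assms in auto)

lemma adj_eqI: "(\<And>u. cinner (A u) y = cinner u x) \<Longrightarrow> adj A y = x"
  by (rule adj_on_eqI) auto

text \<open>
  The real representing vector of \<open>u \<mapsto> Re \<langle>A u, y\<rangle>\<close> also represents the imaginary part, as one sees on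
  replacing \<open>u\<close> by \<open>i u\<close>.
\<close>

lemma cinner_adj:
  fixes A :: "'a::complex_hilbert \<Rightarrow> 'b::complex_inner"
  assumes "bounded_op UNIV UNIV A"
  shows "cinner (A u) y = cinner u (adj A y)"
proof -
  have "bounded_linear (\<lambda>u. inner (A u) y)"
    by (intro bounded_linear_compose[OF bounded_linear_inner_left]
        bounded_op_imp_bounded_linear[OF assms])
  then obtain x where x: "\<And>u. inner (A u) y = inner u x"
    by (rule riesz_representation_real) blast
  have "cinner (A u) y = cinner u x" for u
  proof (rule complex_eqI)
    show "Re (cinner (A u) y) = Re (cinner u x)"
      by (simp add: Re_cinner x)
    have "Re (cinner (A (\<i> *\<^sub>C u)) y) = Re (cinner (\<i> *\<^sub>C u) x)"
      by (simp add: Re_cinner x)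
    then show "Im (cinner (A u) y) = Im (cinner u x)"
      by (simp add: bounded_op_scaleC[OF assms] cinner_scaleC_left)
  qed
  then show ?thesis
    using adj_eqI[of A y x] by simp
qed

lemma cinner_adj_left:
  fixes A :: "'a::complex_hilbert \<Rightarrow> 'b::complex_inner"
  assumes "bounded_op UNIV UNIV A"
  shows "cinner (adj A y) u = cinner y (A u)"
  by (metis assms cinner_adj cinner_commute)

lemma adj_adj:
  fixes A :: "'a::complex_hilbert \<Rightarrow> 'b::complex_inner"
  assumes "bounded_op UNIV UNIV A"
  shows "adj (adj A) = A"
  using cinner_adj_left[OF assms] by (intro ext adj_eqI)

lemma norm_adj_le:
  fixes A :: "'a::complex_hilbert \<Rightarrow> 'b::complex_inner"
  assumes "bounded_op UNIV UNIV A" and "\<And>x. norm (A x) \<le> K * norm x" and "0 \<le> K"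
  shows "norm (adj A y) \<le> K * norm y"
proof -
  have "(norm (adj A y))\<^sup>2 = cmod (cinner (A (adj A y)) y)"
    by (simp add: cinner_adj[OF assms(1)] cinner_self norm_power)
  also have "\<dots> \<le> norm (A (adj A y)) * norm y"
    by (rule cmod_cinner_le)
  also have "\<dots> \<le> (K * norm (adj A y)) * norm y"
    by (intro mult_right_mono assms) simp
  finally have "norm (adj A y) * norm (adj A y) \<le> (K * norm y) * norm (adj A y)"
    by (simp add: power2_eq_square mult_ac)
  then show ?thesis
    using \<open>0 \<le> K\<close> by (cases "norm (adj A y) = 0") (auto simp: mult_le_cancel_right)
qed

section \<open>Positive square roots\<close>

text \<open>
  The operator \<open>p(B)\<close> in Horner form, so that its properties follow by induction along
  \<^const>\<open>pCons\<close>.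
\<close>

definition op_poly :: "('a \<Rightarrow> 'a) \<Rightarrow> real poly \<Rightarrow> 'a::real_vector \<Rightarrow> 'a" where
  "op_poly B p = fold_coeffs (\<lambda>a f x. a *\<^sub>R x + B (f x)) p (\<lambda>_. 0)"

lemma op_poly_0 [simp]: "op_poly B 0 x = 0"
  by (simp add: op_poly_def)

lemma op_poly_pCons:
  assumes "linear B"
  shows "op_poly B (pCons a p) x = a *\<^sub>R x + B (op_poly B p x)"
  using linear_0[OF assms] by (cases "a = 0 \<and> p = 0") (auto simp: op_poly_def)

lemma op_poly_intertwine:
  assumes "linear B" "linear B'" "linear R" "\<And>x. R (B x) = B' (R x)"
  shows "R (op_poly B p x) = op_poly B' p (R x)"
  by (induction p)
    (simp_all add: op_poly_pCons assms linear_0[OF assms(3)] linear_add[OF assms(3)] linear_scale[OF assms(3)])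

lemma op_poly_vec_add:
  assumes "linear B"
  shows "op_poly B p (x + y) = op_poly B p x + op_poly B p y"
  by (induction p)
    (simp_all add: op_poly_pCons assms linear_add[OF assms] algebra_simps)

lemma op_poly_vec_scaleR:
  assumes "linear B"
  shows "op_poly B p (r *\<^sub>R x) = r *\<^sub>R op_poly B p x"
  by (induction p)
    (simp_all add: op_poly_pCons assms linear_scale[OF assms] algebra_simps)

lemma op_poly_add:
  assumes "linear B"
  shows "op_poly B (p + q) x = op_poly B p x + op_poly B q x"
  by (induct p q rule: poly_induct2)
    (simp_all add: op_poly_pCons assms linear_add[OF assms] algebra_simps)

lemma op_poly_smult:
  assumes "linear B"
  shows "op_poly B (smult a p) x = a *\<^sub>R op_poly B p x"
  by (induction p)
    (simp_all add: op_poly_pCons assms linear_scale[OF assms] algebra_simps)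

lemma op_poly_diff:
  assumes "linear B"
  shows "op_poly B (p - q) x = op_poly B p x - op_poly B q x"
  using op_poly_add[OF assms, of "p - q" q x] by simp

lemma op_poly_mult:
  assumes "linear B"
  shows "op_poly B (p * q) x = op_poly B p (op_poly B q x)"
  by (induction p)
    (simp_all add: op_poly_pCons op_poly_add op_poly_smult assms)

text \<open>The polynomial is dominated by its value at \<open>1\<close> because \<open>\<parallel>B\<^sup>k\<parallel> \<le> 1\<close> for every \<open>k\<close>.\<close>

lemma norm_op_poly_le:
  fixes B :: "'a::real_normed_vector \<Rightarrow> 'a"
  assumes "linear B" and "\<And>x. norm (B x) \<le> norm x" and "\<And>k. coeff p k \<ge> 0"
  shows "norm (op_poly B p x) \<le> poly p 1 * norm x"
  using assms(3)
proof (induction p)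
  case (pCons a p)
  have "a \<ge> 0" and "\<And>k. coeff p k \<ge> 0"
    using pCons.prems[of 0] pCons.prems[of "Suc k" for k] by simp_all
  then have "norm (op_poly B p x) \<le> poly p 1 * norm x"
    using pCons.IH by blast
  then have "norm (a *\<^sub>R x + B (op_poly B p x)) \<le> a * norm x + poly p 1 * norm x"
    using \<open>a \<ge> 0\<close> by (intro norm_triangle_le add_mono order_trans[OF assms(2)]) auto
  then show ?case
    by (simp add: op_poly_pCons assms(1) algebra_simps)
qed simp

lemma cinner_op_poly:
  fixes B :: "'a::complex_inner \<Rightarrow> 'a"
  assumes "linear B" and "\<And>x y. cinner (B x) y = cinner x (B y)"
  shows "cinner (op_poly B p x) y = cinner x (op_poly B p y)"
proof (induction p arbitrary: x y)
  case (pCons a p)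
  have "cinner (B (op_poly B p x)) y = cinner x (op_poly B p (B y))"
    by (simp only: assms(2) pCons.IH)
  also have "op_poly B p (B y) = B (op_poly B p y)"
    by (rule op_poly_intertwine[symmetric]) (auto simp: assms(1))
  finally show ?case
    by (simp add: op_poly_pCons assms(1) cinner_add_left cinner_add_right cinner_scaleC_left
        cinner_scaleC_right flip: scaleC_of_real)
qed simp

text \<open>
  Fixed points \<open>Y\<close> of the step \<open>Y \<mapsto> (B + Y\<^sup>2) / 2\<close> satisfy \<open>(I - Y)\<^sup>2 = I - B\<close>.  As a polynomial
  in \<open>B\<close>, each iterate exceeds the preceding one by a polynomial with nonnegative coefficients.
\<close>

primrec sqrt_iter :: "nat \<Rightarrow> real poly" where
  "sqrt_iter 0 = 0"
| "sqrt_iter (Suc n) = smult (1/2) ([:0, 1:] + sqrt_iter n * sqrt_iter n)"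

lemma coeff_mult_nonneg:
  fixes p q :: "real poly"
  assumes "\<And>k. coeff p k \<ge> 0" and "\<And>k. coeff q k \<ge> 0"
  shows "coeff (p * q) k \<ge> 0"
  unfolding coeff_mult by (intro sum_nonneg mult_nonneg_nonneg assms)

lemma coeff_sqrt_iter_nonneg: "coeff (sqrt_iter n) k \<ge> 0"
proof (induction n arbitrary: k)
  case (Suc n)
  then have "coeff (sqrt_iter n * sqrt_iter n) k \<ge> 0"
    by (intro coeff_mult_nonneg)
  moreover have "coeff [:0, 1 :: real:] k \<ge> 0"
    by (simp add: coeff_pCons split: nat.split)
  ultimately show ?case
    by (simp only: sqrt_iter.simps coeff_smult coeff_add) simp
qed simp

lemma coeff_sqrt_iter_Suc_diff_nonneg: "coeff (sqrt_iter (Suc n) - sqrt_iter n) k \<ge> 0"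
proof (induction n arbitrary: k)
  case 0
  then show ?case
    by (simp add: coeff_pCons split: nat.split)
next
  case (Suc n)
  define p q where "p = sqrt_iter (Suc n)" and "q = sqrt_iter n"
  have "sqrt_iter (Suc (Suc n)) - sqrt_iter (Suc n)
      = smult (1/2) ([:0, 1:] + p * p) - smult (1/2) ([:0, 1:] + q * q)"
    by (simp only: p_def q_def sqrt_iter.simps)
  also have "\<dots> = smult (1/2) ((p - q) * (p + q))"
    by (simp only: smult_diff_right[symmetric]) (simp add: algebra_simps)
  finally have eq: "sqrt_iter (Suc (Suc n)) - sqrt_iter (Suc n) = smult (1/2) ((p - q) * (p + q))" .
  have "coeff ((p - q) * (p + q)) k \<ge> 0"
    using Suc coeff_sqrt_iter_nonneg unfolding p_def q_def
    by (intro coeff_mult_nonneg) (simp_all only: coeff_add add_nonneg_nonneg)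
  then show ?case
    unfolding eq by simp
qed

lemma coeff_sqrt_iter_mono:
  assumes "m \<le> n"
  shows "coeff (sqrt_iter m) k \<le> coeff (sqrt_iter n) k"
proof (rule lift_Suc_mono_le[OF _ assms])
  show "coeff (sqrt_iter n) k \<le> coeff (sqrt_iter (Suc n)) k" for n
    using coeff_sqrt_iter_Suc_diff_nonneg[of n k] by (simp only: coeff_diff diff_ge_0_iff_ge)
qed

lemma poly_nonneg_at_1: "(\<And>k. coeff p k \<ge> 0) \<Longrightarrow> poly p (1 :: real) \<ge> 0"
  by (simp add: poly_altdef sum_nonneg)

lemma poly_sqrt_iter_mono: "m \<le> n \<Longrightarrow> poly (sqrt_iter m) 1 \<le> poly (sqrt_iter n) 1"
  using poly_nonneg_at_1[of "sqrt_iter n - sqrt_iter m"] coeff_sqrt_iter_mono[of m n] by simp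

lemma poly_sqrt_iter_le_1: "poly (sqrt_iter n) 1 \<le> 1"
proof (induction n)
  case (Suc n)
  then have "poly (sqrt_iter n) 1 * poly (sqrt_iter n) 1 \<le> 1 * 1"
    by (intro mult_mono poly_nonneg_at_1 coeff_sqrt_iter_nonneg) auto
  then show ?case
    by simp
qed simp

text \<open>This is \<open>I - (I - B)\<^sup>1\<^sup>/\<^sup>2\<close>, the limit of the iterates.\<close>

definition sqrt_remainder :: "('a \<Rightarrow> 'a) \<Rightarrow> 'a::real_normed_vector \<Rightarrow> 'a" where
  "sqrt_remainder B x = lim (\<lambda>n. op_poly B (sqrt_iter n) x)"

lemma norm_op_poly_sqrt_iter_le:
  fixes B :: "'a::real_normed_vector \<Rightarrow> 'a"
  assumes "linear B" and "\<And>x. norm (B x) \<le> norm x"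
  shows "norm (op_poly B (sqrt_iter n) x) \<le> norm x"
proof -
  have "norm (op_poly B (sqrt_iter n) x) \<le> poly (sqrt_iter n) 1 * norm x"
    by (intro norm_op_poly_le assms coeff_sqrt_iter_nonneg)
  also have "\<dots> \<le> norm x"
    by (intro mult_left_le_one_le poly_sqrt_iter_le_1 poly_nonneg_at_1 coeff_sqrt_iter_nonneg) auto
  finally show ?thesis .
qed

text \<open>
  The bound \<open>\<parallel>p\<^sub>n(B) x - p\<^sub>m(B) x\<parallel> \<le> (p\<^sub>n(1) - p\<^sub>m(1)) \<parallel>x\<parallel>\<close> for \<open>m \<le> n\<close> reduces convergence to that of the
  increasing scalar sequence \<open>p\<^sub>n(1) \<le> 1\<close>.
\<close>

lemma sqrt_remainder_tendsto:
  fixes B :: "'a::banach \<Rightarrow> 'a"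
  assumes B: "linear B" "\<And>x. norm (B x) \<le> norm x"
  shows "(\<lambda>n. op_poly B (sqrt_iter n) x) \<longlonglongrightarrow> sqrt_remainder B x"
proof -
  have dist: "norm (op_poly B (sqrt_iter n) x - op_poly B (sqrt_iter m) x)
      \<le> norm (poly (sqrt_iter n) 1 * norm x - poly (sqrt_iter m) 1 * norm x)" if "m \<le> n" for m n
  proof -
    have "norm (op_poly B (sqrt_iter n - sqrt_iter m) x) \<le> poly (sqrt_iter n - sqrt_iter m) 1 * norm x"
      using coeff_sqrt_iter_mono[OF that] by (intro norm_op_poly_le B) simp
    also have "\<dots> \<le> norm (poly (sqrt_iter n) 1 * norm x - poly (sqrt_iter m) 1 * norm x)"
      by (simp add: algebra_simps)
    finally show ?thesis
      by (simp add: op_poly_diff B)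
  qed
  have "convergent (\<lambda>n. poly (sqrt_iter n) 1 * norm x)"
    by (rule Bseq_mono_convergent[OF BseqI'[of _ "norm x"]])
      (auto simp: abs_mult poly_nonneg_at_1 coeff_sqrt_iter_nonneg poly_sqrt_iter_le_1
        intro!: mult_left_le_one_le mult_right_mono poly_sqrt_iter_mono)
  then have cauchy: "Cauchy (\<lambda>n. poly (sqrt_iter n) 1 * norm x)"
    by (rule convergent_Cauchy)
  have "Cauchy (\<lambda>n. op_poly B (sqrt_iter n) x)"
  proof (rule CauchyI)
    fix e :: real assume "e > 0"
    with cauchy obtain M where M: "\<And>m n. m \<ge> M \<Longrightarrow> n \<ge> M \<Longrightarrow>
        norm (poly (sqrt_iter m) 1 * norm x - poly (sqrt_iter n) 1 * norm x) < e"
      by (meson CauchyD)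
    have "norm (op_poly B (sqrt_iter m) x - op_poly B (sqrt_iter n) x) < e"
      if "m \<ge> M" "n \<ge> M" for m n
      using dist[of m n] dist[of n m] M[OF that] M[OF that(2,1)] linear[of m n]
      by (auto simp: norm_minus_commute)
    then show "\<exists>M. \<forall>m\<ge>M. \<forall>n\<ge>M. norm (op_poly B (sqrt_iter m) x - op_poly B (sqrt_iter n) x) < e"
      by blast
  qed
  then show ?thesis
    unfolding sqrt_remainder_def by (metis Cauchy_convergent_iff convergent_LIMSEQ_iff)
qed

lemma norm_sqrt_remainder_le:
  fixes B :: "'a::banach \<Rightarrow> 'a"
  assumes B: "linear B" "\<And>x. norm (B x) \<le> norm x"
  shows "norm (sqrt_remainder B x) \<le> norm x"
  by (rule tendsto_upperbound[OF tendsto_norm[OF sqrt_remainder_tendsto[OF B]]])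
    (simp_all add: norm_op_poly_sqrt_iter_le B)

lemma linear_sqrt_remainder:
  fixes B :: "'a::banach \<Rightarrow> 'a"
  assumes B: "linear B" "\<And>x. norm (B x) \<le> norm x"
  shows "linear (sqrt_remainder B)"
proof (rule linearI)
  note lim = sqrt_remainder_tendsto[OF B]
  show "sqrt_remainder B (x + y) = sqrt_remainder B x + sqrt_remainder B y" for x y
    using tendsto_add[OF lim lim, of x y]
    by (intro LIMSEQ_unique[OF lim]) (simp add: op_poly_vec_add B)
  show "sqrt_remainder B (r *\<^sub>R x) = r *\<^sub>R sqrt_remainder B x" for r x
    using tendsto_scaleR[OF tendsto_const lim, of r x]
    by (intro LIMSEQ_unique[OF lim]) (simp add: op_poly_vec_scaleR B)
qed

lemma sqrt_remainder_fixed_point: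
  fixes B :: "'a::banach \<Rightarrow> 'a"
  assumes B: "linear B" "\<And>x. norm (B x) \<le> norm x"
  shows "2 *\<^sub>R sqrt_remainder B x = B x + sqrt_remainder B (sqrt_remainder B x)"
proof -
  note lim = sqrt_remainder_tendsto[OF B]
  define Y where "Y n = op_poly B (sqrt_iter n)" for n
  define y where "y = sqrt_remainder B x"
  have "(\<lambda>n. Y n (Y n x - y)) \<longlonglongrightarrow> 0"
  proof (rule Lim_null_comparison)
    show "(\<lambda>n. norm (Y n x - y)) \<longlonglongrightarrow> 0"
      using tendsto_norm_zero[OF LIM_zero[OF lim]] unfolding Y_def y_def .
  qed (auto simp: Y_def norm_op_poly_sqrt_iter_le B)
  moreover have "(\<lambda>n. Y n y) \<longlonglongrightarrow> sqrt_remainder B y"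
    unfolding Y_def by (rule lim)
  ultimately have "(\<lambda>n. Y n (Y n x - y) + Y n y) \<longlonglongrightarrow> 0 + sqrt_remainder B y"
    by (rule tendsto_add)
  then have "(\<lambda>n. Y n (Y n x)) \<longlonglongrightarrow> sqrt_remainder B y"
    using op_poly_vec_add[OF B(1), of "sqrt_iter n" "Y n x - y" y for n]
    by (simp add: Y_def)
  then have "(\<lambda>n. B x + Y n (Y n x)) \<longlonglongrightarrow> B x + sqrt_remainder B y"
    by (intro tendsto_intros)
  moreover have "B x + Y n (Y n x) = 2 *\<^sub>R Y (Suc n) x" for n
    by (simp add: Y_def op_poly_smult op_poly_add op_poly_mult op_poly_pCons B linear_0)
  ultimately have "(\<lambda>n. 2 *\<^sub>R Y (Suc n) x) \<longlonglongrightarrow> B x + sqrt_remainder B y"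
    by simp
  moreover have "(\<lambda>n. 2 *\<^sub>R Y (Suc n) x) \<longlonglongrightarrow> 2 *\<^sub>R y"
    unfolding Y_def y_def by (intro tendsto_intros LIMSEQ_Suc lim)
  ultimately show ?thesis
    unfolding y_def by (metis LIMSEQ_unique)
qed

text \<open>
  Three uses: \<open>R\<close> a complex scalar gives complex linearity, \<open>R\<close> a square root of \<open>I - B\<close> gives the
  commutation needed for uniqueness, and \<open>R = T\<close> relates the defect operators of \<open>T\<close> and \<open>T\<^sup>*\<close>.
\<close>

lemma sqrt_remainder_intertwine:
  fixes B :: "'a::banach \<Rightarrow> 'a" and B' :: "'b::banach \<Rightarrow> 'b"
  assumes "linear B" "\<And>x. norm (B x) \<le> norm x" and "linear B'" "\<And>x. norm (B' x) \<le> norm x"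
    and "bounded_linear R" "\<And>x. R (B x) = B' (R x)"
  shows "R (sqrt_remainder B x) = sqrt_remainder B' (R x)"
proof (rule LIMSEQ_unique)
  show "(\<lambda>n. R (op_poly B (sqrt_iter n) x)) \<longlonglongrightarrow> R (sqrt_remainder B x)"
    by (intro bounded_linear.tendsto[OF assms(5)] sqrt_remainder_tendsto assms)
  show "(\<lambda>n. R (op_poly B (sqrt_iter n) x)) \<longlonglongrightarrow> sqrt_remainder B' (R x)"
    unfolding op_poly_intertwine[OF assms(1,3) bounded_linear.linear[OF assms(5)] assms(6)]
    by (intro sqrt_remainder_tendsto assms)
qed

lemma cinner_sqrt_remainder:
  fixes B :: "'a::complex_hilbert \<Rightarrow> 'a"
  assumes "linear B" "\<And>x. norm (B x) \<le> norm x" "\<And>x y. cinner (B x) y = cinner x (B y)"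
  shows "cinner (sqrt_remainder B x) y = cinner x (sqrt_remainder B y)"
proof (rule LIMSEQ_unique)
  show "(\<lambda>n. cinner (op_poly B (sqrt_iter n) x) y) \<longlonglongrightarrow> cinner (sqrt_remainder B x) y"
    by (intro bounded_linear.tendsto[OF bounded_linear_cinner_left] sqrt_remainder_tendsto assms)
  show "(\<lambda>n. cinner (op_poly B (sqrt_iter n) x) y) \<longlonglongrightarrow> cinner x (sqrt_remainder B y)"
    unfolding cinner_op_poly[OF assms(1,3)]
    by (intro bounded_linear.tendsto[OF bounded_linear_cinner_right] sqrt_remainder_tendsto assms)
qed

text \<open>
  If \<open>\<langle>S x, x\<rangle>\<close> is real for every \<open>x\<close>, then polarisation along \<open>x + y\<close> and \<open>x + i y\<close> gives the
  symmetry of \<open>\<langle>S x, y\<rangle>\<close>.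
\<close>

lemma positive_op_selfadjoint:
  assumes "positive_op S"
  shows "cinner (S x) y = cinner x (S y)"
proof -
  have S: "bounded_op UNIV UNIV S" and real: "Im (cinner (S x) x) = 0" for x
    using assms unfolding positive_op_def by (auto simp: complex_nonneg_Reals_iff)
  have "Im (cinner (S x) y) + Im (cinner (S y) x) = 0"
    using real[of "x + y"] real[of x] real[of y]
    by (simp add: bounded_op_add[OF S] cinner_add_left cinner_add_right)
  moreover have "Re (cinner (S y) x) - Re (cinner (S x) y) = 0"
    using real[of "x + \<i> *\<^sub>C y"] real[of x] real[of y]
    by (simp add: bounded_op_add[OF S] bounded_op_scaleC[OF S] cinner_add_left cinner_add_right
        cinner_scaleC_left cinner_scaleC_right algebra_simps)
  ultimately have "cinner (S x) y = cnj (cinner (S y) x)"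
    by (simp add: complex_eq_iff)
  then show ?thesis
    by (simp flip: cinner_commute)
qed

text \<open>
  The form \<open>\<langle>S (y + t S y), y + t S y\<rangle> = 2 t \<parallel>S y\<parallel>\<^sup>2 + t\<^sup>2 \<langle>S S y, S y\<rangle>\<close> takes a negative value for some
  small negative \<open>t\<close> unless \<open>S y = 0\<close>.
\<close>

lemma positive_op_null_vector:
  assumes "positive_op S" and "cinner (S y) y = 0"
  shows "S y = 0"
proof -
  have S: "bounded_op UNIV UNIV S" and nonneg: "0 \<le> Re (cinner (S x) x)" for x
    using assms(1) unfolding positive_op_def by (auto simp: complex_nonneg_Reals_iff)
  note lin = bounded_linear.linear[OF bounded_op_imp_bounded_linear[OF S]]
  define c where "c = inner (S (S y)) (S y)"
  have form: "0 \<le> 2 * t * (norm (S y))\<^sup>2 + t\<^sup>2 * c" for t :: real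
  proof -
    have "inner (S (S y)) y = (norm (S y))\<^sup>2"
      using positive_op_selfadjoint[OF assms(1), of "S y" y]
      by (metis Re_cinner power2_norm_eq_inner)
    moreover have "inner (S y) y = 0"
      using assms(2) by (simp flip: Re_cinner)
    moreover have "inner (S (y + t *\<^sub>R S y)) (y + t *\<^sub>R S y)
        = inner (S y) y + t * inner (S y) (S y) + t * inner (S (S y)) y + t\<^sup>2 * c"
      by (simp add: linear_add[OF lin] linear_scale[OF lin] inner_left_distrib inner_right_distrib
          c_def power2_eq_square algebra_simps)
    moreover have "0 \<le> inner (S (y + t *\<^sub>R S y)) (y + t *\<^sub>R S y)"
      using nonneg by (simp add: Re_cinner)
    ultimately show ?thesis
      by (simp add: power2_norm_eq_inner)
  qed
  have "c \<ge> 0"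
    using nonneg[of "S y"] by (simp add: c_def Re_cinner)
  \<comment> \<open>The choice \<open>t = - s\<close> turns the form into \<open>- s\<^sup>2 (2 + c)\<close>.\<close>
  define s where "s = (norm (S y))\<^sup>2 / (1 + c)"
  have s: "(norm (S y))\<^sup>2 = s * (1 + c)"
    using \<open>c \<ge> 0\<close> by (simp add: s_def field_simps)
  have "0 \<le> - (s\<^sup>2 * (2 + c))"
    using form[of "- s"] unfolding s by (simp add: power2_eq_square algebra_simps)
  then have "s = 0"
    using \<open>c \<ge> 0\<close> by (simp add: mult_le_0_iff)
  then show ?thesis
    using s by simp
qed

text \<open>
  Any other positive square root \<open>S'\<close> of \<open>I - B\<close> commutes with \<open>B\<close>, hence with \<open>S = I - Y\<close>.  With
  \<open>y = (S - S') x\<close> this gives \<open>\<langle>S y, y\<rangle> + \<langle>S' y, y\<rangle> = \<langle>(S\<^sup>2 - S'\<^sup>2) x, y\<rangle> = 0\<close>, so \<open>S y = S' y = 0\<close> and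
  \<open>\<parallel>y\<parallel>\<^sup>2 = \<langle>x, (S - S') y\<rangle> = 0\<close>.
\<close>

lemma
  fixes B :: "'a::complex_hilbert \<Rightarrow> 'a"
  assumes bounded: "bounded_op UNIV UNIV B" and norm_le: "\<And>x. norm (B x) \<le> norm x"
    and selfadjoint: "\<And>x y. cinner (B x) y = cinner x (B y)"
  shows positive_op_id_minus_sqrt_remainder: "positive_op (\<lambda>x. x - sqrt_remainder B x)"
    and pos_sqrt_id_minus: "pos_sqrt (\<lambda>x. x - B x) = (\<lambda>x. x - sqrt_remainder B x)"
proof -
  have B: "linear B"
    by (intro bounded_linear.linear bounded_op_imp_bounded_linear[OF bounded])
  define Y where "Y = sqrt_remainder B"
  define S where "S x = x - Y x" for x
  have Y_linear: "linear Y" and Y_le: "norm (Y x) \<le> norm x"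
    and Y_selfadjoint: "cinner (Y x) y = cinner x (Y y)" for x y
    unfolding Y_def using norm_le selfadjoint
    by (auto intro!: linear_sqrt_remainder norm_sqrt_remainder_le cinner_sqrt_remainder B)
  have "Y (c *\<^sub>C x) = c *\<^sub>C Y x" for c x
    unfolding Y_def
    by (rule sqrt_remainder_intertwine[symmetric])
      (simp_all add: B norm_le bounded_linear_scaleC bounded_op_scaleC[OF bounded])
  moreover have Y_bounded: "bounded_linear Y"
    using Y_le linear_add[OF Y_linear] linear_scale[OF Y_linear]
    by (intro bounded_linear_intro[of Y 1]) auto
  ultimately have S_bounded: "bounded_op UNIV UNIV S"
    unfolding bounded_op_UNIV_iff S_def
    by (auto intro!: bounded_linear_sub bounded_linear_ident simp: scaleC_diff_right)
  have "cinner (S x) x \<in> \<real>\<^sub>\<ge>\<^sub>0" for x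
  proof -
    have "cnj (cinner (Y x) x) = cinner (Y x) x"
      by (metis Y_selfadjoint cinner_commute)
    then have "Im (cinner (Y x) x) = 0"
      by (simp add: complex_eq_iff)
    moreover have "Re (cinner (Y x) x) \<le> (norm x)\<^sup>2"
    proof -
      have "Re (cinner (Y x) x) \<le> norm (Y x) * norm x"
        by (simp add: Re_cinner norm_cauchy_schwarz)
      also have "\<dots> \<le> norm x * norm x"
        by (intro mult_right_mono Y_le) simp
      finally show ?thesis
        by (simp add: power2_eq_square)
    qed
    ultimately show ?thesis
      by (simp add: S_def complex_nonneg_Reals_iff cinner_diff_left cinner_self flip: of_real_power)
  qed
  with S_bounded have S_positive: "positive_op S"
    unfolding positive_op_def by blast
  have S_square: "S (S x) = x - B x" for x
    using sqrt_remainder_fixed_point[OF B norm_le, of x]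
    by (simp add: S_def linear_diff[OF Y_linear] scaleR_2 algebra_simps flip: Y_def)
  have unique: "S' = S" if S': "positive_op S'" and square: "S' \<circ> S' = (\<lambda>x. x - B x)" for S'
  proof
    fix x
    have S'_bounded: "bounded_linear S'"
      using S' by (intro bounded_op_imp_bounded_linear) (auto simp: positive_op_def)
    note S'_diff = linear_diff[OF bounded_linear.linear[OF S'_bounded]]
    note S_diff = linear_diff[OF bounded_linear.linear[OF bounded_op_imp_bounded_linear[OF S_bounded]]]
    have square: "S' (S' x) = x - B x" for x
      using square by (simp add: fun_eq_iff)
    then have "S' (B x) = B (S' x)" for x
    proof -
      have "S' (S' (S' x)) = S' x - S' (B x)"
        using S'_diff by (simp only: square[of x])
      then show ?thesis
        by (simp add: square[of "S' x"])
    qed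
    then have "S' (Y x) = Y (S' x)" for x
      unfolding Y_def by (intro sqrt_remainder_intertwine B norm_le S'_bounded)
    then have commute: "S' (S x) = S (S' x)" for x
      by (simp add: S_def S'_diff)
    define y where "y = S x - S' x"
    have "S y + S' y = 0"
      by (simp add: y_def S_diff S'_diff commute S_square square)
    then have "cinner (S y) y + cinner (S' y) y = 0"
      by (simp flip: cinner_add_left)
    moreover have "cinner (S y) y \<in> \<real>\<^sub>\<ge>\<^sub>0" "cinner (S' y) y \<in> \<real>\<^sub>\<ge>\<^sub>0"
      using S' S_positive unfolding positive_op_def by auto
    ultimately have "cinner (S y) y = 0" "cinner (S' y) y = 0"
      by (auto simp: complex_nonneg_Reals_iff complex_eq_iff)
    then have "S y = 0" "S' y = 0"
      using positive_op_null_vector S' S_positive by blast+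
    moreover have "cinner y y = cinner x (S y) - cinner x (S' y)"
      using positive_op_selfadjoint[OF S_positive, of x y] positive_op_selfadjoint[OF S', of x y]
      by (metis y_def cinner_diff_left)
    ultimately show "S' x = S x"
      by (simp add: y_def)
  qed
  show "positive_op (\<lambda>x. x - sqrt_remainder B x)"
    using S_positive unfolding S_def Y_def .
  have "pos_sqrt (\<lambda>x. x - B x) = S"
    unfolding pos_sqrt_def
  proof (rule the_equality)
    show "positive_op S \<and> S \<circ> S = (\<lambda>x. x - B x)"
      using S_positive S_square by (simp add: fun_eq_iff)
    show "S' = S" if "positive_op S' \<and> S' \<circ> S' = (\<lambda>x. x - B x)" for S'
      using that by (intro unique) simp_all
  qed
  then show "pos_sqrt (\<lambda>x. x - B x) = (\<lambda>x. x - sqrt_remainder B x)"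
    unfolding S_def[abs_def] Y_def .
qed

section \<open>Contractions and their defect operators\<close>

lemma contraction_iff: "contraction T \<longleftrightarrow> bounded_op UNIV UNIV T \<and> (\<forall>x. norm (T x) \<le> norm x)"
proof safe
  assume "contraction T"
  then have T: "bounded_linear T" "onorm T \<le> 1"
    unfolding contraction_def by (auto intro: bounded_op_imp_bounded_linear)
  show "norm (T x) \<le> norm x" for x
    using onorm[OF T(1), of x] mult_right_mono[OF T(2) norm_ge_zero[of x]] by simp
next
  assume "bounded_op UNIV UNIV T" "\<forall>x. norm (T x) \<le> norm x"
  then show "contraction T"
    unfolding contraction_def by (auto intro!: onorm_bound)
qed (simp add: contraction_def)

lemma bounded_op_adj:
  fixes A :: "'a::complex_hilbert \<Rightarrow> 'b::complex_inner"
  assumes A: "bounded_op UNIV UNIV A"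
  shows "bounded_op UNIV UNIV (adj A)"
  unfolding bounded_op_UNIV_iff
proof
  show scale: "\<forall>c x. adj A (c *\<^sub>C x) = c *\<^sub>C adj A x"
    by (auto intro!: adj_eqI simp: cinner_scaleC_right cinner_adj[OF A])
  obtain K where K: "\<And>x. norm (A x) \<le> K * norm x" "0 \<le> K"
    using bounded_linear.nonneg_bounded[OF bounded_op_imp_bounded_linear[OF A]]
    by (auto simp: mult.commute)
  show "bounded_linear (adj A)"
  proof (rule bounded_linear_intro)
    show "adj A (x + y) = adj A x + adj A y" for x y
      by (intro adj_eqI) (simp add: cinner_add_right cinner_adj[OF A])
    show "adj A (r *\<^sub>R x) = r *\<^sub>R adj A x" for r x
      using scale by (metis scaleC_of_real)
    show "norm (adj A x) \<le> norm x * K" for x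
      using norm_adj_le[OF A K] by (simp add: mult.commute)
  qed
qed

lemma contraction_adj:
  assumes "contraction T"
  shows "contraction (adj T)"
  using assms norm_adj_le[of T 1] by (auto simp: contraction_iff bounded_op_adj)

context
  fixes T :: "'h::complex_hilbert \<Rightarrow> 'h"
  assumes T: "contraction T"
begin

lemma contraction_bounded_op: "bounded_op UNIV UNIV T"
  using T by (simp add: contraction_iff)

lemma contraction_linear: "linear T"
  by (rule bounded_linear.linear[OF bounded_op_imp_bounded_linear[OF contraction_bounded_op]])

lemma contraction_norm_le: "norm (T x) \<le> norm x"
  using T by (simp add: contraction_iff)

lemma contraction_adj_adj: "adj (adj T) = T"
  by (rule adj_adj[OF contraction_bounded_op])

lemma contraction_cinner_adj: "cinner (T x) y = cinner x (adj T y)"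
  by (rule cinner_adj[OF contraction_bounded_op])

end

lemma adj_comp_self_contraction:
  assumes "contraction T"
  shows "bounded_op UNIV UNIV (\<lambda>x. adj T (T x))" "norm (adj T (T x)) \<le> norm x"
    "cinner (adj T (T x)) y = cinner x (adj T (T y))"
proof -
  have S: "contraction (adj T)"
    by (rule contraction_adj[OF assms])
  have "bounded_linear (\<lambda>x. adj T (T x))"
    by (intro bounded_linear_compose[of "adj T" T] bounded_op_imp_bounded_linear[of UNIV]
        contraction_bounded_op S assms)
  then show "bounded_op UNIV UNIV (\<lambda>x. adj T (T x))"
    by (simp add: bounded_op_UNIV_iff bounded_op_scaleC[OF contraction_bounded_op[OF assms]]
        bounded_op_scaleC[OF contraction_bounded_op[OF S]])
  show "norm (adj T (T x)) \<le> norm x"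
    using contraction_norm_le[OF S] contraction_norm_le[OF assms] order_trans by blast
  show "cinner (adj T (T x)) y = cinner x (adj T (T y))"
    by (simp add: contraction_cinner_adj[OF S] contraction_adj_adj[OF assms]
        contraction_cinner_adj[OF assms])
qed

lemma defect_op_eq:
  assumes "contraction T"
  shows "defect_op T = (\<lambda>x. x - sqrt_remainder (\<lambda>x. adj T (T x)) x)"
  unfolding defect_op_def by (intro pos_sqrt_id_minus adj_comp_self_contraction assms)

lemma positive_op_defect_op: "contraction T \<Longrightarrow> positive_op (defect_op T)"
  unfolding defect_op_eq
  by (intro positive_op_id_minus_sqrt_remainder adj_comp_self_contraction)

lemma cinner_defect_op: "contraction T \<Longrightarrow> cinner (defect_op T x) y = cinner x (defect_op T y)"
  by (intro positive_op_selfadjoint positive_op_defect_op)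

lemma bounded_op_defect_op: "contraction T \<Longrightarrow> bounded_op UNIV UNIV (defect_op T)"
  using positive_op_defect_op unfolding positive_op_def by blast

lemma bounded_linear_defect_op: "contraction T \<Longrightarrow> bounded_linear (defect_op T)"
  by (rule bounded_op_imp_bounded_linear[OF bounded_op_defect_op])

lemma defect_op_square:
  assumes "contraction T"
  shows "defect_op T (defect_op T x) = x - adj T (T x)"
proof -
  define Y where "Y = sqrt_remainder (\<lambda>x. adj T (T x))"
  have B: "linear (\<lambda>x. adj T (T x))"
    by (intro bounded_linear.linear bounded_op_imp_bounded_linear[OF adj_comp_self_contraction(1)] assms)
  have "linear Y"
    unfolding Y_def by (intro linear_sqrt_remainder B adj_comp_self_contraction(2) assms)
  then have "(x - Y x) - Y (x - Y x) = x - (2 *\<^sub>R Y x - Y (Y x))"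
    by (simp add: linear_diff scaleR_2)
  also have "2 *\<^sub>R Y x = adj T (T x) + Y (Y x)"
    unfolding Y_def by (rule sqrt_remainder_fixed_point[OF B adj_comp_self_contraction(2)[OF assms]])
  finally show ?thesis
    by (simp add: defect_op_eq[OF assms] flip: Y_def)
qed

text \<open>
  \<open>T (T\<^sup>* T) = (T T\<^sup>* ) T\<close>, and the square roots are limits of the same polynomials in \<open>T\<^sup>* T\<close> and in
  \<open>T T\<^sup>*\<close>.
\<close>

lemma defect_op_intertwine:
  assumes "contraction T"
  shows "T (defect_op T x) = defect_op (adj T) (T x)"
proof -
  note S = contraction_adj[OF assms]
  have "T (sqrt_remainder (\<lambda>x. adj T (T x)) x) = sqrt_remainder (\<lambda>x. adj (adj T) (adj T x)) (T x)"
  proof (rule sqrt_remainder_intertwine[where R = T])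
    show "linear (\<lambda>x. adj T (T x))" "linear (\<lambda>x. adj (adj T) (adj T x))"
      by (intro bounded_linear.linear bounded_op_imp_bounded_linear[OF adj_comp_self_contraction(1)]
          assms S)+
    show "bounded_linear T"
      by (rule bounded_op_imp_bounded_linear[OF contraction_bounded_op[OF assms]])
    show "norm (adj (adj T) (adj T x)) \<le> norm x" for x
      by (rule adj_comp_self_contraction(2)[OF S])
  qed (simp_all add: contraction_adj_adj adj_comp_self_contraction(2) assms)
  then show ?thesis
    by (simp add: defect_op_eq assms S linear_diff[OF contraction_linear[OF assms]])
qed

lemma defect_op_adj_intertwine:
  assumes "contraction T"
  shows "adj T (defect_op (adj T) x) = defect_op T (adj T x)"
  using defect_op_intertwine[OF contraction_adj[OF assms]] by (simp add: contraction_adj_adj assms)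

lemma defect_op_adj_square:
  assumes "contraction T"
  shows "defect_op (adj T) (defect_op (adj T) x) = x - T (adj T x)"
  using defect_op_square[OF contraction_adj[OF assms]] by (simp add: contraction_adj_adj assms)

section \<open>Subspaces\<close>

definition closed_csubspace :: "'a::complex_inner set \<Rightarrow> bool" where
  "closed_csubspace E \<longleftrightarrow> closed E \<and> 0 \<in> E \<and> (\<forall>x\<in>E. \<forall>y\<in>E. x + y \<in> E) \<and> (\<forall>c. \<forall>x\<in>E. c *\<^sub>C x \<in> E)"

lemma closed_csubspace_diff: "closed_csubspace E \<Longrightarrow> x \<in> E \<Longrightarrow> y \<in> E \<Longrightarrow> x - y \<in> E"
  unfolding closed_csubspace_def by (metis scaleC_minus_one uminus_add_conv_diff add.commute)

lemma closed_csubspace_sum: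
  "closed_csubspace E \<Longrightarrow> (\<And>k. k \<in> I \<Longrightarrow> f k \<in> E) \<Longrightarrow> sum f I \<in> E"
  by (induction I rule: infinite_finite_induct) (auto simp: closed_csubspace_def)

lemma closed_csubspace_defect_space:
  assumes "contraction T"
  shows "closed_csubspace (defect_space T)"
  unfolding closed_csubspace_def
proof (intro conjI ballI allI)
  note D = bounded_op_defect_op[OF assms]
  note lin = bounded_linear_defect_op[OF assms]
  show "closed (defect_space T)"
    by (simp add: defect_space_def)
  show "0 \<in> defect_space T"
    unfolding defect_space_def
    by (rule subsetD[OF closure_subset]) (metis linear_0[OF bounded_linear.linear[OF lin]] rangeI)
  let ?R = "range (defect_op T)"
  show "x + y \<in> defect_space T" if "x \<in> defect_space T" "y \<in> defect_space T" for x y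
  proof -
    have "bounded_linear (\<lambda>p :: 'a \<times> 'a. fst p + snd p)"
      by (intro bounded_linear_add bounded_linear_fst bounded_linear_snd)
    from closure_bounded_linear_image_subset[OF this, of "?R \<times> ?R"]
    have "x + y \<in> closure ((\<lambda>p. fst p + snd p) ` (?R \<times> ?R))"
      using that by (force simp: closure_Times defect_space_def)
    moreover have "(\<lambda>p. fst p + snd p) ` (?R \<times> ?R) \<subseteq> ?R"
      by (auto simp flip: bounded_op_add[OF D])
    ultimately show ?thesis
      unfolding defect_space_def using closure_mono by blast
  qed
  show "c *\<^sub>C x \<in> defect_space T" if "x \<in> defect_space T" for c x
  proof -
    have "c *\<^sub>C x \<in> closure ((\<lambda>x. c *\<^sub>C x) ` ?R)"
      using closure_bounded_linear_image_subset[OF bounded_linear_scaleC, of c ?R] that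
      by (auto simp: defect_space_def)
    moreover have "(\<lambda>x. c *\<^sub>C x) ` ?R \<subseteq> ?R"
      by (auto simp flip: bounded_op_scaleC[OF D])
    ultimately show ?thesis
      unfolding defect_space_def using closure_mono by blast
  qed
qed

lemma defect_op_in_defect_space: "defect_op T x \<in> defect_space T"
  unfolding defect_space_def by (rule subsetD[OF closure_subset]) simp

lemma cinner_defect_space_kernel:
  assumes T: "contraction T" and x: "x \<in> defect_space T" and w: "defect_op T w = 0"
  shows "cinner x w = 0"
proof -
  have "closed {x. cinner x w = 0}"
    by (rule closed_Collect_eq[OF linear_continuous_on[OF bounded_linear_cinner_left]
          continuous_on_const])
  moreover have "range (defect_op T) \<subseteq> {x. cinner x w = 0}"
    by (auto simp: cinner_defect_op T w)
  ultimately show ?thesis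
    using x closure_minimal[of "range (defect_op T)" "{x. cinner x w = 0}"]
    unfolding defect_space_def by blast
qed

lemma bounded_op_compose:
  assumes "bounded_op E F A" "bounded_op F G B"
  shows "bounded_op E G (\<lambda>x. B (A x))"
proof -
  obtain K where K: "\<And>x. x \<in> E \<Longrightarrow> norm (A x) \<le> K * norm x"
    using assms(1) unfolding bounded_op_def by blast
  obtain L where L: "\<And>x. x \<in> F \<Longrightarrow> norm (B x) \<le> L * norm x"
    using assms(2) unfolding bounded_op_def by blast
  have "norm (B (A x)) \<le> (\<bar>L\<bar> * \<bar>K\<bar>) * norm x" if x: "x \<in> E" for x
  proof -
    have "norm (B (A x)) \<le> \<bar>L\<bar> * norm (A x)"
      using L[OF bounded_op_mem[OF assms(1) x]] by (rule order_trans) (simp add: mult_right_mono)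
    also have "\<dots> \<le> \<bar>L\<bar> * (\<bar>K\<bar> * norm x)"
    proof (rule mult_left_mono)
      show "norm (A x) \<le> \<bar>K\<bar> * norm x"
        using K[OF x] by (rule order_trans) (simp add: mult_right_mono)
    qed simp
    finally show ?thesis
      by (simp add: mult.assoc)
  qed
  then have "\<exists>K. \<forall>x\<in>E. norm (B (A x)) \<le> K * norm x"
    by blast
  moreover have "A x \<in> F" if "x \<in> E" for x
    using bounded_op_mem[OF assms(1) that] .
  ultimately show ?thesis
    unfolding bounded_op_def[of E G]
    by (simp add: bounded_op_add[OF assms(1)] bounded_op_scaleC[OF assms(1)]
        bounded_op_add[OF assms(2)] bounded_op_scaleC[OF assms(2)] bounded_op_mem[OF assms(2)]
        image_subset_iff)
qed

lemma bounded_op_perp: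
  assumes "bounded_op E E P" and E: "closed_csubspace E"
  shows "bounded_op E E (perp P)"
proof -
  obtain K where K: "\<And>x. x \<in> E \<Longrightarrow> norm (P x) \<le> K * norm x"
    using assms(1) unfolding bounded_op_def by blast
  have "norm (perp P x) \<le> (1 + K) * norm x" if "x \<in> E" for x
    using norm_triangle_ineq4[of x "P x"] K[OF that] by (simp add: perp_def algebra_simps)
  then have "\<exists>K. \<forall>x\<in>E. norm (perp P x) \<le> K * norm x"
    by blast
  moreover have "perp P x \<in> E" if "x \<in> E" for x
    unfolding perp_def by (intro closed_csubspace_diff[OF E] that bounded_op_mem[OF assms(1)])
  ultimately show ?thesis
    unfolding bounded_op_def[of E E "perp P"]
    by (simp add: image_subset_iff perp_def scaleC_diff_right bounded_op_add[OF assms(1)]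
        bounded_op_scaleC[OF assms(1)])
qed

lemma bounded_op_sums:
  assumes A: "bounded_op E F A" and E: "closed_csubspace E"
    and "\<And>k. x k \<in> E" and "x sums s"
  shows "(\<lambda>k. A (x k)) sums A s"
proof -
  obtain K where K: "\<And>x. x \<in> E \<Longrightarrow> norm (A x) \<le> K * norm x"
    using A unfolding bounded_op_def by blast
  have sum: "sum x {..<n} \<in> E" for n
    by (intro closed_csubspace_sum E assms)
  have lim: "(\<lambda>n. sum x {..<n}) \<longlonglongrightarrow> s"
    using assms(4) by (simp add: sums_def)
  have "closed E"
    using E unfolding closed_csubspace_def by blast
  then have "s \<in> E"
    using closed_sequentially[of E "\<lambda>n. sum x {..<n}" s] sum lim by blast
  have zero: "A 0 = 0"
    using bounded_op_scaleC[OF A, of 0 0] E unfolding closed_csubspace_def by simp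
  have A_sum: "A (sum x {..<n}) = (\<Sum>k<n. A (x k))" for n
    by (induction n) (simp_all add: zero bounded_op_add[OF A sum assms(3)])
  have A_diff: "A (u - v) = A u - A v" if "u \<in> E" "v \<in> E" for u v
    using bounded_op_add[OF A closed_csubspace_diff[OF E that] that(2)] by (simp add: algebra_simps)
  have "(\<lambda>n. A (sum x {..<n}) - A s) \<longlonglongrightarrow> 0"
  proof (rule Lim_null_comparison)
    have "norm (A (sum x {..<n}) - A s) \<le> K * norm (sum x {..<n} - s)" for n
      using K[OF closed_csubspace_diff[OF E sum \<open>s \<in> E\<close>]] by (simp only: A_diff[OF sum \<open>s \<in> E\<close>])
    then show "\<forall>\<^sub>F n in sequentially. norm (A (sum x {..<n}) - A s) \<le> K * norm (sum x {..<n} - s)"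
      by (rule always_eventually[OF allI])
    show "(\<lambda>n. K * norm (sum x {..<n} - s)) \<longlonglongrightarrow> 0"
      using tendsto_mult_right_zero[OF tendsto_norm_zero[OF LIM_zero[OF lim]]] .
  qed
  then show ?thesis
    unfolding A_sum by (simp add: sums_def LIM_zero_iff)
qed

section \<open>Unitaries and orthogonal projections\<close>

lemma orth_proj_eqI:
  assumes "y \<in> M" and "\<And>u. u \<in> M \<Longrightarrow> cinner (x - y) u = 0"
    and "\<And>u v. u \<in> M \<Longrightarrow> v \<in> M \<Longrightarrow> u - v \<in> M"
  shows "orth_proj M x = y"
  unfolding orth_proj_def
proof (rule the_equality)
  fix y' assume y': "y' \<in> M \<and> (\<forall>u\<in>M. cinner (x - y') u = 0)"
  then have "cinner (x - y) (y' - y) = 0" "cinner (x - y') (y' - y) = 0"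
    using assms by auto
  then have "cinner (y' - y) (y' - y) = 0"
    by (simp add: cinner_diff_left)
  then show "y' = y"
    by simp
qed (use assms in auto)

lemma
  assumes U: "unitary_between E F U" and E: "closed_csubspace E" and y: "y \<in> F"
  shows adj_on_unitary_mem: "adj_on E U y \<in> E"
    and cinner_adj_on_unitary: "u \<in> E \<Longrightarrow> cinner (U u) y = cinner u (adj_on E U y)"
proof -
  obtain x where x: "x \<in> E" "y = U x"
    using U y unfolding unitary_between_def by blast
  moreover have *: "cinner (U u) y = cinner u x" if "u \<in> E" for u
    using U that x unfolding unitary_between_def by blast
  ultimately have "adj_on E U y = x"
    using closed_csubspace_diff[OF E] by (intro adj_on_eqI) auto
  with x * show "adj_on E U y \<in> E" "u \<in> E \<Longrightarrow> cinner (U u) y = cinner u (adj_on E U y)"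
    by auto
qed

lemma cinner_perp:
  assumes "projection_on E P" "x \<in> E" "y \<in> E"
  shows "cinner (perp P x) y = cinner x (perp P y)"
  using assms unfolding projection_on_def perp_def by (simp add: cinner_diff_left cinner_diff_right)

section \<open>Vector-valued Hardy functions\<close>

lemma mult_op_eqI:
  assumes "\<And>z. z \<in> ball 0 1 \<Longrightarrow> hardy_eval g z = \<phi> z (hardy_eval f z)"
  shows "mult_op \<phi> f = g"
  unfolding mult_op_def
proof (rule the_equality)
  show "\<forall>z\<in>ball 0 1. hardy_eval g z = \<phi> z (hardy_eval f z)"
    using assms by blast
  show "g' = g" if "\<forall>z\<in>ball 0 1. hardy_eval g' z = \<phi> z (hardy_eval f z)" for g'
    using that assms unfolding hardy_eq_iff by metis
qed

lemma hardy_spaceI: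
  assumes E: "closed_csubspace E" and "\<And>k. hardy_coeff f k \<in> E"
  shows "f \<in> hardy_space E"
  unfolding hardy_space_def
proof (intro CollectI ballI)
  fix z :: complex assume "z \<in> ball 0 1"
  then have "(\<lambda>n. \<Sum>k<n. z ^ k *\<^sub>C hardy_coeff f k) \<longlonglongrightarrow> hardy_eval f z"
    using hardy_eval_sums[of z f] unfolding sums_def by simp
  moreover have "(\<Sum>k<n. z ^ k *\<^sub>C hardy_coeff f k) \<in> E" for n
    using E assms(2) by (intro closed_csubspace_sum) (auto simp: closed_csubspace_def)
  moreover have "closed E"
    using E unfolding closed_csubspace_def by blast
  ultimately show "hardy_eval f z \<in> E"
    using closed_sequentially[of E "\<lambda>n. \<Sum>k<n. z ^ k *\<^sub>C hardy_coeff f k"] by simp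
qed

text \<open>
  The values of \<open>f\<close> being orthogonal to \<open>w\<close>, so are its coefficients, by uniqueness of the power
  series of the scalar function \<open>\<langle>f(z), w\<rangle>\<close>.
\<close>

lemma cinner_hardy_coeff_eq_0:
  assumes "f \<in> hardy_space E" and "\<And>x. x \<in> E \<Longrightarrow> cinner x w = 0"
  shows "cinner (hardy_coeff f k) w = 0"
proof -
  have "\<forall>z\<in>ball 0 1. (\<lambda>k. cinner (hardy_coeff f k) w * z ^ k) sums 0"
  proof
    fix z :: complex assume z: "z \<in> ball 0 1"
    then have "cinner (hardy_eval f z) w = 0"
      using assms unfolding hardy_space_def by blast
    then show "(\<lambda>k. cinner (hardy_coeff f k) w * z ^ k) sums 0"
      using bounded_linear.sums[OF bounded_linear_cinner_left[of w] hardy_eval_sums[OF z, of f]]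
      by (simp add: cinner_scaleC_left mult.commute)
  qed
  moreover have "\<forall>z\<in>ball 0 1. (\<lambda>k. (0 :: complex) * z ^ k) sums 0"
    by simp
  ultimately have "(\<lambda>k. cinner (hardy_coeff f k) w) = (\<lambda>k. 0)"
    by (rule complex_power_series_unique)
  then show ?thesis
    by (rule fun_cong)
qed

lemma sum_hardy_coeff_le: "(\<Sum>k<n. (norm (hardy_coeff f k))\<^sup>2) \<le> (norm f)\<^sup>2"
  using sum_le_suminf[OF square_summable_hardy_coeff[of f], of "{..<n}"] norm_hardy_sums[of f]
  by (simp add: sums_iff)

lemma hardy_monomial:
  fixes v :: "'a::complex_hilbert"
  obtains u where "hardy_coeff u = (\<lambda>j. if j = k then v else 0)"
proof -
  have "summable (\<lambda>j. (norm (if j = k then v else 0))\<^sup>2)"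
    by (rule summable_finite[of "{k}"]) auto
  then show thesis
    by (rule hardy_of_coeffs) (rule that)
qed

lemma hardy_backward_shift:
  fixes f :: "'a::complex_hilbert hardy"
  obtains L where "\<And>k j. hardy_coeff (L k) j = hardy_coeff f (k + j)" and "L \<longlonglongrightarrow> 0"
proof -
  let ?c = "\<lambda>j. (norm (hardy_coeff f j))\<^sup>2"
  have summable: "summable (\<lambda>j. ?c (k + j))" for k
    using summable_ignore_initial_segment[OF square_summable_hardy_coeff, of f k]
    by (simp add: add.commute)
  then have "\<exists>g. hardy_coeff g = (\<lambda>j. hardy_coeff f (k + j))" for k
    by (metis hardy_of_coeffs)
  then obtain L where L: "\<And>k. hardy_coeff (L k) = (\<lambda>j. hardy_coeff f (k + j))"
    by metis
  have "(norm (L k))\<^sup>2 = suminf ?c - sum ?c {..<k}" for k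
  proof -
    have "(\<lambda>j. ?c (k + j)) sums ((norm (L k))\<^sup>2)"
      using norm_hardy_sums[of "L k"] by (simp add: L)
    then show ?thesis
      using suminf_minus_initial_segment[OF square_summable_hardy_coeff[of f], of k]
      by (simp add: sums_iff add.commute)
  qed
  moreover have "(\<lambda>k. suminf ?c - sum ?c {..<k}) \<longlonglongrightarrow> suminf ?c - suminf ?c"
    by (intro tendsto_diff tendsto_const summable_LIMSEQ square_summable_hardy_coeff)
  ultimately have "(\<lambda>k. (norm (L k))\<^sup>2) \<longlonglongrightarrow> 0"
    by simp
  then have "(\<lambda>k. sqrt ((norm (L k))\<^sup>2)) \<longlonglongrightarrow> sqrt 0"
    by (rule tendsto_real_sqrt)
  then have "L \<longlonglongrightarrow> 0"
    by (intro tendsto_norm_zero_cancel[of L]) simp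
  with L show thesis
    by (intro that[of L]) simp_all
qed

text \<open>
  The pairing with the multiplier \<open>A + z B\<close>, rearranged by the coefficients of \<open>f\<close>: the
  \<open>k\<close>-th one meets the \<open>k\<close>-th one of \<open>g\<close> through \<open>A\<close> and the next one through \<open>B\<close>.  In this form
  the adjoint of the multiplier can be read off term by term.
\<close>

lemma linear_multiplier_pairing:
  fixes A B :: "'a::complex_hilbert \<Rightarrow> 'a"
  assumes E: "closed_csubspace E" and A: "bounded_op E E A" and B: "bounded_op E E B"
    and f: "\<And>k. hardy_coeff f k \<in> E"
  shows "(\<lambda>k. cinner (A (hardy_coeff f k)) (hardy_coeff g k) +
      cinner (B (hardy_coeff f k)) (hardy_coeff g (Suc k)))
    sums cinner (mult_op (\<lambda>z x. A x + z *\<^sub>C B x) f) g"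
proof -
  have square_summable: "summable (\<lambda>k. (norm (C (hardy_coeff f k)))\<^sup>2)" if "bounded_op E E C" for C
  proof -
    obtain K where K: "\<And>x. x \<in> E \<Longrightarrow> norm (C x) \<le> K * norm x"
      using \<open>bounded_op E E C\<close> unfolding bounded_op_def by blast
    have "(norm (C (hardy_coeff f k)))\<^sup>2 \<le> K\<^sup>2 * (norm (hardy_coeff f k))\<^sup>2" for k
      using power_mono[OF K[OF f] norm_ge_zero, of k 2] by (simp add: power_mult_distrib)
    then show ?thesis
      by (intro summable_comparison_test'[OF summable_mult[OF square_summable_hardy_coeff]]) auto
  qed
  obtain F where F: "hardy_coeff F = (\<lambda>k. A (hardy_coeff f k))"
    by (rule hardy_of_coeffs[OF square_summable[OF A]])
  define b where "b k = (case k of 0 \<Rightarrow> 0 | Suc j \<Rightarrow> B (hardy_coeff f j))" for k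
  have "summable (\<lambda>k. (norm (b (Suc k)))\<^sup>2)"
    using square_summable[OF B] by (simp add: b_def)
  then have "summable (\<lambda>k. (norm (b k))\<^sup>2)"
    by (subst (asm) summable_Suc_iff)
  then obtain G where G: "hardy_coeff G = b"
    by (rule hardy_of_coeffs)
  have "mult_op (\<lambda>z x. A x + z *\<^sub>C B x) f = F + G"
  proof (rule mult_op_eqI)
    fix z :: complex assume z: "z \<in> ball 0 1"
    have in_E: "z ^ k *\<^sub>C hardy_coeff f k \<in> E" for k
      using E f unfolding closed_csubspace_def by blast
    have "(\<lambda>k. z ^ k *\<^sub>C A (hardy_coeff f k)) sums A (hardy_eval f z)"
      using bounded_op_sums[OF A E in_E hardy_eval_sums[OF z]] by (simp add: bounded_op_scaleC[OF A f])
    then have "hardy_eval F z = A (hardy_eval f z)"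
      using hardy_eval_sums[OF z, of F] unfolding F by (rule sums_unique2[rotated])
    moreover have "(\<lambda>k. z ^ k *\<^sub>C B (hardy_coeff f k)) sums B (hardy_eval f z)"
      using bounded_op_sums[OF B E in_E hardy_eval_sums[OF z]] by (simp add: bounded_op_scaleC[OF B f])
    then have "(\<lambda>k. z ^ Suc k *\<^sub>C b (Suc k)) sums (z *\<^sub>C B (hardy_eval f z))"
      using bounded_linear.sums[OF bounded_linear_scaleC[of z]] by (fastforce simp: b_def scaleC_scaleC)
    then have "(\<lambda>k. z ^ k *\<^sub>C b k) sums (z *\<^sub>C B (hardy_eval f z))"
      by (drule_tac sums_Suc) (simp add: b_def)
    then have "hardy_eval G z = z *\<^sub>C B (hardy_eval f z)"
      using hardy_eval_sums[OF z, of G] unfolding G by (rule sums_unique2[rotated])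
    ultimately show "hardy_eval (F + G) z = A (hardy_eval f z) + z *\<^sub>C B (hardy_eval f z)"
      by (simp add: hardy_eval_plus)
  qed
  moreover have "(\<lambda>k. cinner (A (hardy_coeff f k)) (hardy_coeff g k)) sums cinner F g"
    using cinner_hardy_sums[of F g] by (simp add: F)
  moreover have "(\<lambda>k. cinner (b (Suc k)) (hardy_coeff g (Suc k))) sums cinner G g"
    using cinner_hardy_sums[of G g] unfolding G by (subst sums_Suc_iff) (simp add: b_def)
  ultimately show ?thesis
    by (simp add: cinner_add_left sums_add b_def)
qed

section \<open>The characteristic function as a transfer function\<close>

text \<open>
  State and output of the discrete linear system with state operator \<open>T\<^sup>*\<close> that starts at rest and
  is driven by the input \<open>u\<close>.
\<close>

primrec char_state :: "('h::complex_hilbert \<Rightarrow> 'h) \<Rightarrow> (nat \<Rightarrow> 'h) \<Rightarrow> nat \<Rightarrow> 'h" where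
  "char_state T u 0 = 0"
| "char_state T u (Suc k) = adj T (char_state T u k) + defect_op T (u k)"

definition char_output :: "('h::complex_hilbert \<Rightarrow> 'h) \<Rightarrow> (nat \<Rightarrow> 'h) \<Rightarrow> nat \<Rightarrow> 'h" where
  "char_output T u k = defect_op (adj T) (char_state T u k) - T (u k)"

context
  fixes T :: "'h::complex_hilbert \<Rightarrow> 'h"
  assumes T: "contraction T"
begin

lemma adj_contraction: "contraction (adj T)"
  by (rule contraction_adj[OF T])

lemma adj_linear: "linear (adj T)"
  by (rule contraction_linear[OF adj_contraction])

lemma defect_linear: "linear (defect_op T)" "linear (defect_op (adj T))"
  using bounded_linear_defect_op[OF T] bounded_linear_defect_op[OF adj_contraction]
  by (auto intro: bounded_linear.linear)

lemma cinner_adj_contraction: "cinner (adj T x) y = cinner x (T y)"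
  using contraction_cinner_adj[OF adj_contraction] by (simp add: contraction_adj_adj[OF T])

lemma colligation_adjoint:
  "cinner (adj T x + defect_op T u) a + cinner (defect_op (adj T) x - T u) b =
    cinner x (T a + defect_op (adj T) b) + cinner u (defect_op T a - adj T b)"
  by (simp add: cinner_add_left cinner_add_right cinner_diff_left cinner_diff_right
      cinner_adj_contraction contraction_cinner_adj[OF T] cinner_defect_op[OF T]
      cinner_defect_op[OF adj_contraction])

text \<open>
  The adjoint colligation sends the pair on the left back to \<open>(x, u)\<close>: the diagonal terms give
  \<open>T T\<^sup>* + D\<^sub>T\<^sub>*\<^sup>2 = I\<close> and \<open>T\<^sup>* T + D\<^sub>T\<^sup>2 = I\<close>, and the mixed terms cancel by the intertwining relations of
  the defect operators.
\<close>

lemma colligation_isometric: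
  "(norm (adj T x + defect_op T u))\<^sup>2 + (norm (defect_op (adj T) x - T u))\<^sup>2 =
    (norm x)\<^sup>2 + (norm u)\<^sup>2"
proof -
  let ?a = "adj T x + defect_op T u" and ?b = "defect_op (adj T) x - T u"
  have "T ?a + defect_op (adj T) ?b = x"
    by (simp add: linear_add[OF contraction_linear[OF T]] linear_diff[OF defect_linear(2)]
        defect_op_adj_square[OF T] defect_op_intertwine[OF T])
  moreover have "defect_op T ?a - adj T ?b = u"
    by (simp add: linear_add[OF defect_linear(1)] linear_diff[OF adj_linear]
        defect_op_square[OF T] defect_op_adj_intertwine[OF T])
  ultimately have "cinner ?a ?a + cinner ?b ?b = cinner x x + cinner u u"
    using colligation_adjoint[of x u ?a ?b] by simp
  then have "complex_of_real ((norm ?a)\<^sup>2 + (norm ?b)\<^sup>2) = of_real ((norm x)\<^sup>2 + (norm u)\<^sup>2)"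
    by (simp add: cinner_self)
  then show ?thesis
    by (simp only: of_real_eq_iff)
qed

lemma char_energy_balance:
  "(\<Sum>k<n. (norm (char_output T u k))\<^sup>2) + (norm (char_state T u n))\<^sup>2 = (\<Sum>k<n. (norm (u k))\<^sup>2)"
proof (induction n)
  case (Suc n)
  show ?case
    using Suc colligation_isometric[of "char_state T u n" "u n"]
    by (simp add: char_output_def)
qed simp

lemma norm_char_state_le: "norm (char_state T (hardy_coeff u) n) \<le> norm u"
proof -
  have "(norm (char_state T (hardy_coeff u) n))\<^sup>2 \<le> (\<Sum>k<n. (norm (hardy_coeff u k))\<^sup>2)"
    using char_energy_balance[of "hardy_coeff u" n]
      sum_nonneg[of "{..<n}" "\<lambda>k. (norm (char_output T (hardy_coeff u) k))\<^sup>2"] by simp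
  also have "\<dots> \<le> (norm u)\<^sup>2"
    by (rule sum_hardy_coeff_le)
  finally show ?thesis
    by (simp add: power2_le_iff_abs_le)
qed

text \<open>
  Generating functions turn the recursion into \<open>x(z) = z w(z)\<close>, \<open>(I - z T\<^sup>*) w(z) = D\<^sub>T u(z)\<close> and
  \<open>y(z) = D\<^sub>T\<^sub>* x(z) - T u(z)\<close>, which is the formula for the characteristic function.  The energy
  balance makes the output square summable and the states bounded, so that \<open>w(z)\<close> converges.
\<close>

lemma hardy_coeff_mult_char_fun:
  "hardy_coeff (mult_op (char_fun T) u) = char_output T (hardy_coeff u)"
proof -
  let ?D = "defect_op T" and ?D' = "defect_op (adj T)"
  define x where "x = char_state T (hardy_coeff u)"
  have x_le: "norm (x k) \<le> norm u" for k
    unfolding x_def by (rule norm_char_state_le)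
  have "summable (\<lambda>k. (norm (char_output T (hardy_coeff u) k))\<^sup>2)"
  proof (rule summableI_nonneg_bounded)
    show "(\<Sum>k<n. (norm (char_output T (hardy_coeff u) k))\<^sup>2) \<le> (norm u)\<^sup>2" for n
      using char_energy_balance[of "hardy_coeff u" n] sum_hardy_coeff_le[of u n]
        zero_le_power2[of "norm (char_state T (hardy_coeff u) n)"] by linarith
  qed simp
  then obtain g where g: "hardy_coeff g = char_output T (hardy_coeff u)"
    by (rule hardy_of_coeffs)
  have "mult_op (char_fun T) u = g"
  proof (rule mult_op_eqI)
    fix z :: complex assume z: "z \<in> ball 0 1"
    note bl = bounded_op_imp_bounded_linear[OF contraction_bounded_op[OF T]]
      bounded_op_imp_bounded_linear[OF contraction_bounded_op[OF adj_contraction]]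
      bounded_linear_defect_op[OF T] bounded_linear_defect_op[OF adj_contraction]
    note scale = bounded_op_scaleC[OF contraction_bounded_op[OF T] UNIV_I]
      bounded_op_scaleC[OF contraction_bounded_op[OF adj_contraction] UNIV_I]
      bounded_op_scaleC[OF bounded_op_defect_op[OF T] UNIV_I]
      bounded_op_scaleC[OF bounded_op_defect_op[OF adj_contraction] UNIV_I]
    have u_sums: "(\<lambda>k. z ^ k *\<^sub>C hardy_coeff u k) sums hardy_eval u z"
      by (rule hardy_eval_sums[OF z])
    have "summable (\<lambda>k. z ^ k *\<^sub>C x (Suc k))"
    proof (rule summable_comparison_test')
      show "summable (\<lambda>k. cmod z ^ k * norm u)"
        using z by (intro summable_mult2 summable_geometric) simp
      show "norm (z ^ k *\<^sub>C x (Suc k)) \<le> cmod z ^ k * norm u" for k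
        by (simp add: norm_scaleC norm_power mult_left_mono x_le)
    qed
    then obtain w where w: "(\<lambda>k. z ^ k *\<^sub>C x (Suc k)) sums w"
      unfolding summable_def by blast
    have "(\<lambda>k. z ^ Suc k *\<^sub>C x (Suc k)) sums (z *\<^sub>C w)"
      using bounded_linear.sums[OF bounded_linear_scaleC[of z] w] by (simp add: scaleC_scaleC)
    from sums_Suc[OF this] have x_sums: "(\<lambda>k. z ^ k *\<^sub>C x k) sums (z *\<^sub>C w)"
      by (simp add: x_def)
    have "(\<lambda>k. adj T (z ^ k *\<^sub>C x k) + ?D (z ^ k *\<^sub>C hardy_coeff u k))
        sums (adj T (z *\<^sub>C w) + ?D (hardy_eval u z))"
      by (rule sums_add[OF bounded_linear.sums[OF bl(2) x_sums] bounded_linear.sums[OF bl(3) u_sums]])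
    then have "(\<lambda>k. z ^ k *\<^sub>C x (Suc k)) sums (z *\<^sub>C adj T w + ?D (hardy_eval u z))"
      by (simp add: x_def scale scaleC_add_right)
    with w have resolvent: "w - z *\<^sub>C adj T w = ?D (hardy_eval u z)"
      by (metis add_diff_cancel_left' sums_unique2)
    have "inj (\<lambda>y. y - z *\<^sub>C adj T y)"
    proof (rule injI)
      fix v v' assume "v - z *\<^sub>C adj T v = v' - z *\<^sub>C adj T v'"
      then have "v - v' = z *\<^sub>C adj T (v - v')"
        by (simp add: linear_diff[OF adj_linear] scaleC_diff_right algebra_simps)
      then have "norm (v - v') = cmod z * norm (adj T (v - v'))"
        by (metis norm_scaleC)
      also have "\<dots> \<le> cmod z * norm (v - v')"
        by (intro mult_left_mono contraction_norm_le[OF adj_contraction]) simp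
      finally have "(1 - cmod z) * norm (v - v') \<le> 0"
        by (simp add: algebra_simps)
      then show "v = v'"
        using z by (auto simp: mult_le_0_iff)
    qed
    then have w_eq: "inv (\<lambda>y. y - z *\<^sub>C adj T y) (?D (hardy_eval u z)) = w"
      using resolvent by (rule inv_f_eq)
    have "(\<lambda>k. ?D' (z ^ k *\<^sub>C x k) - T (z ^ k *\<^sub>C hardy_coeff u k))
        sums (?D' (z *\<^sub>C w) - T (hardy_eval u z))"
      by (rule sums_diff[OF bounded_linear.sums[OF bl(4) x_sums] bounded_linear.sums[OF bl(1) u_sums]])
    then have "(\<lambda>k. z ^ k *\<^sub>C hardy_coeff g k) sums char_fun T z (hardy_eval u z)"
      by (simp add: g char_output_def x_def scale scaleC_diff_right char_fun_def w_eq)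
    then show "hardy_eval g z = char_fun T z (hardy_eval u z)"
      using hardy_eval_sums[OF z] by (rule sums_unique2[rotated])
  qed
  then show ?thesis
    by (simp add: g)
qed

text \<open>
  Here \<open>a\<close> is a state trajectory of the adjoint system driven backwards in time by the
  coefficients of \<open>f\<close>, and \<open>b\<^sub>k = D\<^sub>T a\<^sub>k\<^sub>+\<^sub>1 - T\<^sup>* f\<^sub>k\<close> is its output.  The adjointness relation makes the difference of the partial sums of
  \<open>\<langle>u\<^sub>k, b\<^sub>k\<rangle>\<close> and \<open>\<langle>y\<^sub>k, f\<^sub>k\<rangle>\<close> telescope to \<open>\<langle>x\<^sub>n, a\<^sub>n\<rangle>\<close>, which tends to \<open>0\<close>.
\<close>

lemma mult_char_fun_pairing:
  assumes a: "\<And>k. a k = T (a (Suc k)) + defect_op (adj T) (hardy_coeff f k)"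
    and "a \<longlonglongrightarrow> 0"
  shows "(\<lambda>k. cinner (hardy_coeff u k) (defect_op T (a (Suc k)) - adj T (hardy_coeff f k)))
    sums cinner (mult_op (char_fun T) u) f"
proof -
  define x where "x = char_state T (hardy_coeff u)"
  define b where "b k = defect_op T (a (Suc k)) - adj T (hardy_coeff f k)" for k
  have partial: "(\<Sum>k<n. cinner (hardy_coeff u k) (b k)) =
      (\<Sum>k<n. cinner (char_output T (hardy_coeff u) k) (hardy_coeff f k)) + cinner (x n) (a n)" for n
  proof (induction n)
    case (Suc n)
    have "cinner (x (Suc n)) (a (Suc n)) + cinner (char_output T (hardy_coeff u) n) (hardy_coeff f n)
        = cinner (x n) (a n) + cinner (hardy_coeff u n) (b n)"
      using colligation_adjoint[of "x n" "hardy_coeff u n" "a (Suc n)" "hardy_coeff f n"]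
      by (simp add: x_def b_def char_output_def a[of n])
    then show ?case
      using Suc by (simp add: algebra_simps)
  qed (simp add: x_def)
  have "(\<lambda>n. cinner (x n) (a n)) \<longlonglongrightarrow> 0"
  proof (rule Lim_null_comparison)
    have "cmod (cinner (x n) (a n)) \<le> norm u * norm (a n)" for n
      using cmod_cinner_le[of "x n" "a n"] mult_right_mono[OF norm_char_state_le[of u n], of "norm (a n)"]
      unfolding x_def by simp
    then show "\<forall>\<^sub>F n in sequentially. cmod (cinner (x n) (a n)) \<le> norm u * norm (a n)"
      by simp
    show "(\<lambda>n. norm u * norm (a n)) \<longlonglongrightarrow> 0"
      by (rule tendsto_mult_right_zero[OF tendsto_norm_zero[OF \<open>a \<longlonglongrightarrow> 0\<close>]])
  qed
  moreover have "(\<lambda>n. \<Sum>k<n. cinner (char_output T (hardy_coeff u) k) (hardy_coeff f k))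
      \<longlonglongrightarrow> cinner (mult_op (char_fun T) u) f"
    using cinner_hardy_sums[of "mult_op (char_fun T) u" f]
    unfolding hardy_coeff_mult_char_fun sums_def .
  ultimately have "(\<lambda>n. \<Sum>k<n. cinner (hardy_coeff u k) (b k))
      \<longlonglongrightarrow> cinner (mult_op (char_fun T) u) f + 0"
    unfolding partial by (intro tendsto_add)
  then show ?thesis
    unfolding sums_def b_def by simp
qed

end

section \<open>The embedding into the Hardy space\<close>

definition model_embedding :: "('h::complex_hilbert \<Rightarrow> 'h) \<Rightarrow> 'h \<Rightarrow> 'h hardy" where
  "model_embedding T h = (THE f. hardy_coeff f = (\<lambda>k. defect_op (adj T) ((adj T ^^ k) h)))"

context
  fixes T :: "'h::complex_hilbert \<Rightarrow> 'h"
  assumes T: "C_dot_0_contraction T"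
begin

lemma C_dot_0_imp_contraction: "contraction T"
  using T by (simp add: C_dot_0_contraction_def)

lemma C_dot_0_tendsto: "(\<lambda>k. (adj T ^^ k) x) \<longlonglongrightarrow> 0"
  using T unfolding C_dot_0_contraction_def by blast

text \<open>
  The \<open>k\<close>-th term is \<open>\<langle>S\<^sup>k x, S\<^sup>k y\<rangle> - \<langle>S\<^sup>k\<^sup>+\<^sup>1 x, S\<^sup>k\<^sup>+\<^sup>1 y\<rangle>\<close> with \<open>S = T\<^sup>*\<close>, as \<open>D\<^sub>T\<^sub>*\<^sup>2 = I - T S\<close>.
\<close>

lemma defect_telescope_sums:
  "(\<lambda>k. cinner (defect_op (adj T) ((adj T ^^ k) x)) (defect_op (adj T) ((adj T ^^ k) y)))
    sums cinner x y"
proof -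
  note contraction = C_dot_0_imp_contraction
  define c where "c k = cinner ((adj T ^^ k) x) ((adj T ^^ k) y)" for k
  have "c \<longlonglongrightarrow> 0"
  proof (rule Lim_null_comparison)
    show "\<forall>\<^sub>F k in sequentially. norm (c k) \<le> norm ((adj T ^^ k) x) * norm ((adj T ^^ k) y)"
      unfolding c_def by (intro always_eventually allI cmod_cinner_le)
    show "(\<lambda>k. norm ((adj T ^^ k) x) * norm ((adj T ^^ k) y)) \<longlonglongrightarrow> 0"
      by (intro tendsto_mult_zero tendsto_norm_zero C_dot_0_tendsto)
  qed
  then have "(\<lambda>k. c k - c (Suc k)) sums (c 0 - 0)"
    by (rule telescope_sums')
  moreover have "c k - c (Suc k) =
      cinner (defect_op (adj T) ((adj T ^^ k) x)) (defect_op (adj T) ((adj T ^^ k) y))" for k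
    by (simp add: c_def cinner_defect_op[OF adj_contraction[OF contraction]]
        defect_op_adj_square[OF contraction] cinner_diff_right cinner_adj_contraction[OF contraction])
  ultimately show ?thesis
    by (simp add: c_def)
qed

lemma hardy_coeff_model_embedding:
  "hardy_coeff (model_embedding T h) = (\<lambda>k. defect_op (adj T) ((adj T ^^ k) h))"
proof -
  have "summable (\<lambda>k. (norm (defect_op (adj T) ((adj T ^^ k) h)))\<^sup>2)"
    using sums_summable[OF sums_Re[OF defect_telescope_sums[of h h]]] by (simp add: cinner_self)
  then obtain f where f: "hardy_coeff f = (\<lambda>k. defect_op (adj T) ((adj T ^^ k) h))"
    by (rule hardy_of_coeffs)
  then have "model_embedding T h = f"
    unfolding model_embedding_def by (intro the_equality) (simp_all flip: hardy_coeff_inject)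
  then show ?thesis
    by (simp add: f)
qed

lemma cinner_model_embedding: "cinner (model_embedding T x) (model_embedding T y) = cinner x y"
  using cinner_hardy_sums[of "model_embedding T x" "model_embedding T y"] defect_telescope_sums[of x y]
  unfolding hardy_coeff_model_embedding by (rule sums_unique2)

lemma norm_model_embedding: "norm (model_embedding T x) = norm x"
  using cinner_model_embedding[of x x] by (simp add: norm_eq_sqrt_inner flip: Re_cinner)

lemma bounded_op_model_embedding: "bounded_op UNIV UNIV (model_embedding T)"
proof -
  let ?D = "defect_op (adj T)"
  note S = adj_contraction[OF C_dot_0_imp_contraction]
  have pow_add: "(adj T ^^ k) (x + y) = (adj T ^^ k) x + (adj T ^^ k) y" for k x y
    by (induction k) (simp_all add: linear_add[OF contraction_linear[OF S]])
  have pow_scale: "(adj T ^^ k) (c *\<^sub>C x) = c *\<^sub>C (adj T ^^ k) x" for k c x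
    by (induction k) (simp_all add: bounded_op_scaleC[OF contraction_bounded_op[OF S]])
  have "model_embedding T (x + y) = model_embedding T x + model_embedding T y" for x y
    by (simp add: hardy_coeff_model_embedding hardy_coeff_plus fun_eq_iff pow_add
        bounded_op_add[OF bounded_op_defect_op[OF S]] flip: hardy_coeff_inject)
  moreover have "model_embedding T (c *\<^sub>C x) = c *\<^sub>C model_embedding T x" for c x
    by (simp add: hardy_coeff_model_embedding hardy_coeff_scaleC fun_eq_iff pow_scale
        bounded_op_scaleC[OF bounded_op_defect_op[OF S]] flip: hardy_coeff_inject)
  moreover have "\<exists>K. \<forall>x. norm (model_embedding T x) \<le> K * norm x"
    by (intro exI[of _ 1]) (simp add: norm_model_embedding)
  ultimately show ?thesis
    unfolding bounded_op_def by simp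
qed

text \<open>
  For \<open>f = V h\<close> the trajectory \<open>a\<^sub>k = T\<^sup>*\<^sup>k h\<close> solves the backward recursion, and its output
  \<open>D\<^sub>T T\<^sup>*\<^sup>k\<^sup>+\<^sup>1 h - T\<^sup>* D\<^sub>T\<^sub>* T\<^sup>*\<^sup>k h\<close> vanishes by the intertwining relation.
\<close>

lemma model_embedding_in_model_space: "model_embedding T h \<in> model_space T"
proof -
  let ?f = "model_embedding T h"
  note contraction = C_dot_0_imp_contraction
  have "?f \<in> hardy_space (defect_space (adj T))"
    by (intro hardy_spaceI closed_csubspace_defect_space adj_contraction contraction)
      (simp add: hardy_coeff_model_embedding defect_op_in_defect_space)
  moreover have "cinner ?f (mult_op (char_fun T) u) = 0" for u
  proof -
    have "(adj T ^^ k) h = T ((adj T ^^ Suc k) h) + defect_op (adj T) (hardy_coeff ?f k)" for k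
      by (simp add: hardy_coeff_model_embedding defect_op_adj_square[OF contraction])
    from mult_char_fun_pairing[OF contraction this C_dot_0_tendsto, of u]
    have "(\<lambda>k. 0) sums cinner (mult_op (char_fun T) u) ?f"
      by (simp add: hardy_coeff_model_embedding defect_op_adj_intertwine[OF contraction])
    then have "cinner (mult_op (char_fun T) u) ?f = 0"
      using sums_unique2 sums_zero by blast
    then show ?thesis
      by (subst cinner_commute) simp
  qed
  ultimately show ?thesis
    unfolding model_space_def by blast
qed

text \<open>
  The backward trajectory driven by \<open>f\<close> is \<open>a\<^sub>k = V\<^sup>* L\<^sub>k f\<close>, with \<open>L\<^sub>k\<close> the \<open>k\<close>-fold backward shift;
  it tends to \<open>0\<close> because \<open>L\<^sub>k f\<close> does.  Orthogonality of \<open>f\<close> to the outputs of the inputs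
  \<open>z\<^sup>k D\<^sub>T x\<close> makes the backward output \<open>b\<^sub>k\<close> orthogonal to the defect space of \<open>T\<close>.  This gives
  \<open>T\<^sup>* a\<^sub>k = a\<^sub>k\<^sub>+\<^sub>1\<close> and \<open>D\<^sub>T\<^sub>* a\<^sub>k = f\<^sub>k + T b\<^sub>k\<close>.  The vector \<open>T b\<^sub>k\<close> lies in the kernel of \<open>D\<^sub>T\<^sub>*\<close>, whereas
  \<open>f\<^sub>k\<close> is orthogonal to that kernel because \<open>f\<close> takes values in the defect space of \<open>T\<^sup>*\<close>; so \<open>T b\<^sub>k\<close> is
  \<open>0\<close> and \<open>f = V a\<^sub>0\<close>.
\<close>

lemma model_embedding_surj_model_space:
  assumes f: "f \<in> model_space T"
  shows "f \<in> range (model_embedding T)"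
proof -
  let ?D = "defect_op T" and ?D' = "defect_op (adj T)" and ?V = "model_embedding T"
  note contraction = C_dot_0_imp_contraction
  note linear_rules = linear_add[OF contraction_linear[OF contraction]]
    linear_diff[OF contraction_linear[OF contraction]]
    linear_add[OF adj_linear[OF contraction]] linear_diff[OF adj_linear[OF contraction]]
    linear_add[OF defect_linear(1)[OF contraction]] linear_diff[OF defect_linear(1)[OF contraction]]
    linear_add[OF defect_linear(2)[OF contraction]] linear_diff[OF defect_linear(2)[OF contraction]]
  have in_hardy: "f \<in> hardy_space (defect_space (adj T))"
    and orth: "\<And>u. u \<in> hardy_space (defect_space T) \<Longrightarrow> cinner f (mult_op (char_fun T) u) = 0"
    using f unfolding model_space_def by blast+
  obtain L where L: "\<And>k j. hardy_coeff (L k) j = hardy_coeff f (k + j)" and "L \<longlonglongrightarrow> 0"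
    by (rule hardy_backward_shift) blast
  define a where "a k = adj ?V (L k)" for k
  define b where "b k = ?D (a (Suc k)) - adj T (hardy_coeff f k)" for k
  have a_step: "a k = T (a (Suc k)) + ?D' (hardy_coeff f k)" for k
  proof (rule cinner_eqI)
    fix h
    have "(\<lambda>j. cinner (?D' ((adj T ^^ j) h)) (hardy_coeff f (k + j))) sums cinner h (a k)"
      using cinner_hardy_sums[of "?V h" "L k"]
      by (simp add: a_def hardy_coeff_model_embedding L flip: cinner_adj[OF bounded_op_model_embedding])
    moreover have "(\<lambda>j. cinner (?D' ((adj T ^^ Suc j) h)) (hardy_coeff f (k + Suc j)))
        sums cinner (adj T h) (a (Suc k))"
      using cinner_hardy_sums[of "?V (adj T h)" "L (Suc k)"]
      by (simp add: a_def hardy_coeff_model_embedding L funpow_swap1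
          flip: cinner_adj[OF bounded_op_model_embedding])
    from sums_Suc[OF this]
    have "(\<lambda>j. cinner (?D' ((adj T ^^ j) h)) (hardy_coeff f (k + j)))
        sums (cinner (adj T h) (a (Suc k)) + cinner (?D' h) (hardy_coeff f k))"
      by simp
    ultimately have "cinner h (a k) = cinner (adj T h) (a (Suc k)) + cinner (?D' h) (hardy_coeff f k)"
      by (rule sums_unique2)
    then show "cinner h (a k) = cinner h (T (a (Suc k)) + ?D' (hardy_coeff f k))"
      by (simp add: cinner_add_right cinner_adj_contraction[OF contraction]
          cinner_defect_op[OF adj_contraction[OF contraction]])
  qed
  have "a \<longlonglongrightarrow> 0"
  proof (rule Lim_null_comparison)
    have "norm (a k) \<le> norm (L k)" for k
      using norm_adj_le[OF bounded_op_model_embedding, of 1 "L k"]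
      by (simp add: a_def norm_model_embedding)
    then show "\<forall>\<^sub>F k in sequentially. norm (a k) \<le> norm (L k)"
      by simp
    show "(\<lambda>k. norm (L k)) \<longlonglongrightarrow> 0"
      by (rule tendsto_norm_zero[OF \<open>L \<longlonglongrightarrow> 0\<close>])
  qed
  have D_b: "?D (b k) = 0" for k
  proof -
    have "cinner (?D x) (b k) = 0" for x
    proof -
      obtain u where u: "hardy_coeff u = (\<lambda>j. if j = k then ?D x else 0)"
        by (rule hardy_monomial)
      have "0 \<in> defect_space T"
        using closed_csubspace_defect_space[OF contraction] unfolding closed_csubspace_def by blast
      then have "u \<in> hardy_space (defect_space T)"
        by (intro hardy_spaceI closed_csubspace_defect_space contraction)
          (simp add: u defect_op_in_defect_space)
      then have "cinner f (mult_op (char_fun T) u) = 0"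
        by (rule orth)
      then have "cinner (mult_op (char_fun T) u) f = 0"
        by (metis cinner_commute complex_cnj_zero)
      then have "(\<lambda>j. cinner (hardy_coeff u j) (b j)) sums 0"
        using mult_char_fun_pairing[OF contraction a_step \<open>a \<longlonglongrightarrow> 0\<close>, of u] by (simp add: b_def)
      moreover have "(\<lambda>j. cinner (hardy_coeff u j) (b j)) sums (\<Sum>j\<in>{k}. cinner (hardy_coeff u j) (b j))"
        by (rule sums_finite) (simp_all add: u)
      ultimately have "(\<Sum>j\<in>{k}. cinner (hardy_coeff u j) (b j)) = 0"
        using sums_unique2 by blast
      then show ?thesis
        by (simp add: u)
    qed
    from this[of "?D (b k)"] show ?thesis
      using cinner_defect_op[OF contraction, of "?D (b k)" "b k"] by simp
  qed
  have D'_a: "?D' (a k) = hardy_coeff f k + T (b k)" for k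
    by (simp add: a_step[of k] b_def linear_rules defect_op_adj_square[OF contraction]
        defect_op_intertwine[OF contraction, symmetric])
  have S_a: "adj T (a k) = a (Suc k)" for k
  proof -
    have "adj T (a k) = a (Suc k) - ?D (b k)"
      by (simp add: a_step[of k] b_def linear_rules defect_op_square[OF contraction]
          defect_op_adj_intertwine[OF contraction])
    then show ?thesis
      by (simp add: D_b)
  qed
  have T_b: "T (b k) = 0" for k
  proof -
    have kernel: "?D' (T (b k)) = 0"
      using D_b[of k] linear_0[OF contraction_linear[OF contraction]]
      by (simp flip: defect_op_intertwine[OF contraction])
    have "cinner (hardy_coeff f k) (T (b k)) = 0"
      by (rule cinner_hardy_coeff_eq_0[OF in_hardy])
        (rule cinner_defect_space_kernel[OF adj_contraction[OF contraction] _ kernel])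
    moreover have "cinner (?D' (a k)) (T (b k)) = 0"
      by (simp add: cinner_defect_op[OF adj_contraction[OF contraction]] kernel)
    ultimately have "cinner (T (b k)) (T (b k)) = 0"
      by (simp add: D'_a cinner_add_left)
    then show ?thesis
      by simp
  qed
  have "a k = (adj T ^^ k) (a 0)" for k
    by (induction k) (simp_all flip: S_a)
  moreover have "hardy_coeff f k = ?D' (a k)" for k
    by (simp add: D'_a T_b)
  ultimately have "hardy_coeff f k = ?D' ((adj T ^^ k) (a 0))" for k
    by metis
  then have "hardy_coeff f = hardy_coeff (?V (a 0))"
    unfolding hardy_coeff_model_embedding by (rule ext)
  then show ?thesis
    unfolding hardy_coeff_inject by blast
qed

lemma unitary_between_model_embedding:
  "unitary_between UNIV (model_space T) (model_embedding T)"
proof -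
  have range: "range (model_embedding T) = model_space T"
    using model_embedding_in_model_space model_embedding_surj_model_space by blast
  moreover have "bounded_op UNIV (model_space T) (model_embedding T)"
    using bounded_op_model_embedding range unfolding bounded_op_def by simp
  ultimately show ?thesis
    unfolding unitary_between_def by (simp add: cinner_model_embedding)
qed

end

section \<open>Compressed multipliers\<close>

lemma op_prod_commute:
  assumes "\<And>i. i \<in> {1..n} \<Longrightarrow> A i \<circ> X = X \<circ> A i"
  shows "op_prod n A \<circ> X = X \<circ> op_prod n A"
proof -
  have "foldr (\<lambda>i B. A i \<circ> B) is id \<circ> X = X \<circ> foldr (\<lambda>i B. A i \<circ> B) is id"
    if "set is \<subseteq> {1..n}" for "is"
    using that
  proof (induction "is")
    case (Cons i "is")
    then have "A i \<circ> X = X \<circ> A i"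
      using assms by simp
    with Cons show ?case
      by (simp add: fun_eq_iff)
  qed simp
  moreover have "set [1..<Suc n] \<subseteq> {1..n}"
    by (auto simp del: upt_Suc)
  ultimately show ?thesis
    unfolding op_prod_def by blast
qed

lemma adj_commute:
  fixes A B :: "'a::complex_hilbert \<Rightarrow> 'a"
  assumes "bounded_op UNIV UNIV A" "bounded_op UNIV UNIV B" and "A \<circ> B = B \<circ> A"
  shows "adj A (adj B x) = adj B (adj A x)"
proof (rule cinner_eqI)
  fix u
  have "A (B u) = B (A u)"
    using assms(3) by (simp add: fun_eq_iff)
  then show "cinner u (adj A (adj B x)) = cinner u (adj B (adj A x))"
    by (simp flip: cinner_adj[OF assms(1)] cinner_adj[OF assms(2)])
qed

text \<open>
  Since \<open>X\<^sup>*\<close> commutes with \<open>S = T\<^sup>*\<close>, the \<open>k\<close>-th coefficient of \<open>V X\<^sup>* h\<close> is \<open>D X\<^sup>* S\<^sup>k h\<close>, which the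
  factorisation expresses by the \<open>k\<close>-th and the next coefficient of \<open>V h\<close>.  Pairing with \<open>V x\<close> gives
  \<open>\<langle>M V x, V h\<rangle> = \<langle>V x, V X\<^sup>* h\<rangle> = \<langle>V X x, V h\<rangle>\<close>, so \<open>M V x - V X x\<close> is orthogonal to the range of \<open>V\<close>.
\<close>

lemma model_embedding_compression:
  fixes T X P U :: "'h::complex_hilbert \<Rightarrow> 'h"
  assumes T: "C_dot_0_contraction T" and X: "bounded_op UNIV UNIV X" and commute: "X \<circ> T = T \<circ> X"
    and E_def: "E = defect_space (adj T)"
    and P: "projection_on E P" and U: "unitary_between E E U"
    and factor: "\<And>x. defect_op (adj T) (adj X x) =
        perp P (adj_on E U (defect_op (adj T) x)) + P (adj_on E U (defect_op (adj T) (adj T x)))"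
  shows "orth_proj (model_space T)
      (mult_op (\<lambda>z x. U (perp P x) + z *\<^sub>C U (P x)) (model_embedding T x)) = model_embedding T (X x)"
proof -
  let ?V = "model_embedding T" and ?D' = "defect_op (adj T)"
  let ?M = "mult_op (\<lambda>z x. U (perp P x) + z *\<^sub>C U (P x))"
  note contraction = C_dot_0_imp_contraction[OF T]
  note coeff = hardy_coeff_model_embedding[OF T]
  have E: "closed_csubspace E"
    unfolding E_def by (intro closed_csubspace_defect_space adj_contraction contraction)
  have P_bounded: "bounded_op E E P" and U_bounded: "bounded_op E E U"
    using P U unfolding projection_on_def unitary_between_def by blast+
  have P_selfadjoint: "cinner (P u) v = cinner u (P v)" if "u \<in> E" "v \<in> E" for u v
    using P that unfolding projection_on_def by blast
  have coeff_in_E: "hardy_coeff (?V h) k \<in> E" for h k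
    by (simp add: coeff E_def defect_op_in_defect_space)
  have pow_commute: "adj X ((adj T ^^ k) h) = (adj T ^^ k) (adj X h)" for k h
    by (induction k) (simp_all add: adj_commute[OF X contraction_bounded_op[OF contraction] commute])
  have pairing: "cinner (?M (?V x)) (?V h) = cinner (?V x) (?V (adj X h))" for h
  proof -
    let ?g = "hardy_coeff (?V x)" and ?y = "hardy_coeff (?V h)"
    have "cinner (?g k) (hardy_coeff (?V (adj X h)) k)
        = cinner (U (perp P (?g k))) (?y k) + cinner (U (P (?g k))) (?y (Suc k))" for k
    proof -
      have "hardy_coeff (?V (adj X h)) k = perp P (adj_on E U (?y k)) + P (adj_on E U (?y (Suc k)))"
        by (simp add: coeff factor flip: pow_commute)
      moreover have "cinner (U (perp P (?g k))) (?y k) = cinner (?g k) (perp P (adj_on E U (?y k)))"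
        using cinner_adj_on_unitary[OF U E coeff_in_E[of h k]
            bounded_op_mem[OF bounded_op_perp[OF P_bounded E] coeff_in_E[of x k]]]
          cinner_perp[OF P coeff_in_E[of x k] adj_on_unitary_mem[OF U E coeff_in_E[of h k]]]
        by simp
      moreover have "cinner (U (P (?g k))) (?y (Suc k)) = cinner (?g k) (P (adj_on E U (?y (Suc k))))"
        using cinner_adj_on_unitary[OF U E coeff_in_E[of h "Suc k"]
            bounded_op_mem[OF P_bounded coeff_in_E[of x k]]]
          P_selfadjoint[OF coeff_in_E[of x k] adj_on_unitary_mem[OF U E coeff_in_E[of h "Suc k"]]]
        by simp
      ultimately show ?thesis
        by (simp add: cinner_add_right)
    qed
    then have "(\<lambda>k. cinner (?g k) (hardy_coeff (?V (adj X h)) k)) sums cinner (?M (?V x)) (?V h)"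
      using linear_multiplier_pairing[OF E bounded_op_compose[OF bounded_op_perp[OF P_bounded E] U_bounded]
          bounded_op_compose[OF P_bounded U_bounded] coeff_in_E[of x], of "?V h"] by simp
    then show ?thesis
      using cinner_hardy_sums by (rule sums_unique2)
  qed
  note V_bounded = bounded_op_imp_bounded_linear[OF bounded_op_model_embedding[OF T]]
  have range: "range ?V = model_space T"
    using unitary_between_model_embedding[OF T] unfolding unitary_between_def by blast
  show ?thesis
  proof (rule orth_proj_eqI)
    show "?V (X x) \<in> model_space T"
      unfolding range[symmetric] by (rule rangeI)
    show "cinner (?M (?V x) - ?V (X x)) u = 0" if "u \<in> model_space T" for u
    proof -
      obtain h where "u = ?V h"
        using \<open>u \<in> model_space T\<close> unfolding range[symmetric] by (rule rangeE)
      then show ?thesis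
        by (simp add: cinner_diff_left pairing cinner_model_embedding[OF T] cinner_adj[OF X])
    qed
    show "u - v \<in> model_space T" if "u \<in> model_space T" "v \<in> model_space T" for u v
      using that linear_diff[OF bounded_linear.linear[OF V_bounded], symmetric]
      unfolding range[symmetric] by (elim rangeE) simp
  qed
qed

theorem theorem4p3:
  fixes n :: nat
    and Ts P U :: "nat \<Rightarrow> 'h \<Rightarrow> 'h::complex_hilbert"
    and T :: "'h \<Rightarrow> 'h"
    and E :: "'h set"
  assumes "1 \<le> n"
    and "\<And>i. i \<in> {1..n} \<Longrightarrow> contraction (Ts i)"
    and "\<And>i j. i \<in> {1..n} \<Longrightarrow> j \<in> {1..n} \<Longrightarrow> Ts i \<circ> Ts j = Ts j \<circ> Ts i"
    and "T = op_prod n Ts"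
    and "C_dot_0_contraction T"
    and "E = defect_space (adj T)"
    and "\<And>i. i \<in> {1..n} \<Longrightarrow> projection_on E (P i)"
    and "\<And>i. i \<in> {1..n} \<Longrightarrow> unitary_between E E (U i)"
    and "\<And>i j x. i \<in> {1..n} \<Longrightarrow> j \<in> {1..n} \<Longrightarrow> x \<in> E \<Longrightarrow> U i (U j x) = U j (U i x)"
    and "\<And>i x. i \<in> {1..n} \<Longrightarrow>
      defect_op (adj T) (adj (Ts i) x) =
        perp (P i) (adj_on E (U i) (defect_op (adj T) x)) +
        P i (adj_on E (U i) (defect_op (adj T) (adj T x)))"
    and "\<And>i j x. i \<in> {1..n} \<Longrightarrow> j \<in> {1..n} \<Longrightarrow> x \<in> E \<Longrightarrow>
      perp (P i) (adj_on E (U i) (perp (P j) (adj_on E (U j) x))) =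
      perp (P j) (adj_on E (U j) (perp (P i) (adj_on E (U i) x)))"
    and "\<And>i j x. i \<in> {1..n} \<Longrightarrow> j \<in> {1..n} \<Longrightarrow> x \<in> E \<Longrightarrow>
      U i (P i (U j (P j x))) = U j (P j (U i (P i x)))"
  shows "unitarily_equivalent n UNIV Ts (model_space T)
    (\<lambda>i f. orth_proj (model_space T)
      (mult_op (\<lambda>z x. U i (perp (P i) x) + z *\<^sub>C U i (P i x)) f))"
  unfolding unitarily_equivalent_def
proof (intro exI[of _ "model_embedding T"] conjI ballI)
  show "unitary_between UNIV (model_space T) (model_embedding T)"
    by (rule unitary_between_model_embedding[OF assms(5)])
  fix i x assume i: "i \<in> {1..n}"
  have "op_prod n Ts \<circ> Ts i = Ts i \<circ> op_prod n Ts"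
    by (rule op_prod_commute) (rule assms(3)[OF _ i])
  then have "Ts i \<circ> T = T \<circ> Ts i"
    by (simp add: assms(4))
  from model_embedding_compression[OF assms(5) contraction_bounded_op[OF assms(2)[OF i]] this
      assms(6) assms(7)[OF i] assms(8)[OF i] assms(10)[OF i], of x]
  show "model_embedding T (Ts i x) = orth_proj (model_space T)
      (mult_op (\<lambda>z x. U i (perp (P i) x) + z *\<^sub>C U i (P i x)) (model_embedding T x))"
    by simp
qed

end
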